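(* Let $X$ be a real Banach space and let $A\colon X\rightrightarrows X^*$ be a monotone linear relation such that $\operatorname{gra} A$ is closed. Then the following are equivalent: (i) $A$ is maximally monotone of type (D). (ii) $A$ is maximally monotone of type (NI). (iii) $A$ is maximally monotone of type (FP). (iv) The adjoint $A^*$ is monotone.
   Context: $X$ is identified with its canonical image in $X^{**}$; $X^*$ is the continuous dual. For a set-valued operator $A\colon X\rightrightarrows X^*$ (each $Ax\subseteq X^*$), $\operatorname{gra}A=\{(x,x^* )\in X\times X^*\mid x^*\in Ax\}$ and $\operatorname{ran}A=\bigcup_{x\in X}Ax$. $A$ is a linear relation if $\operatorname{gra}A$ is a linear subspace of $X\times X^*$. "Closed" for the graph means norm closed in $X\times X^*$. For $U\times V\subseteq X\times X^*$, $A$ is monotone with respect to $U\times V$ if $\langle x-y,x^*-y^*\rangle\ge 0$ for all $(x,x^* ),(y,y^* )\in(\operatorname{gra}A)\cap(U\times V)$. $A$ is maximally monotone with respect to $U\times V$ if it is monotone with respect to $U\times V$ and for every $B\colon X\rightrightarrows X^*$ that is monotone with respect to $U\times V$ with $(\operatorname{gra}A)\cap(U\times V)\subseteq(\operatorname{gra}B)\cap(U\times V)$ one has $(\operatorname{gra}A)\cap(U\times V)=(\operatorname{gra}B)\cap(U\times V)$. (Maximally) monotone without qualification means with respect to $X\times X^*$. The adjoint $A^*$ of a linear relation $A$ is given by $\operatorname{gra}A^*=\{(x^{**},x^* )\in X^{**}\times X^*\mid \langle a,x^*\rangle=\langle a^*,x^{**}\rangle\ \forall (a,a^* )\in\operatorname{gra}A\}$.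 $A^*$ is monotone if $\langle x^{**}-y^{**},x^*-y^*\rangle\ge0$ for all $(x^{**},x^* ),(y^{**},y^* )\in\operatorname{gra}A^*$. A maximally monotone $A\colon X\rightrightarrows X^*$ is: - of type (D) if for every $(x^{**},x^* )\in X^{**}\times X^*$ with $\inf_{(a,a^* )\in\operatorname{gra}A}\langle a-x^{**},a^*-x^*\rangle\ge0$ there is a bounded net $(a_\alpha,a^*_\alpha)$ in $\operatorname{gra}A$ converging to $(x^{**},x^* )$ in the weak$^*\times$strong sense ($a_\alpha\to x^{**}$ in $\sigma(X^{**},X^* )$, $a_\alpha^*\to x^*$ in norm); - of type (NI) if $\sup_{(a,a^* )\in\operatorname{gra}A}\big(\langle a,x^*\rangle+\langle a^*,x^{**}\rangle-\langle a,a^*\rangle\big)\ge\langle x^{**},x^*\rangle$ for all $(x^{**},x^* )\in X^{**}\times X^*$; - of type (FP) if for every open convex $V\subseteq X^*$ with $V\cap\operatorname{ran}A\ne\varnothing$, $A$ is maximally monotone with respect to $X\times V$. *)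

theory Defs
  imports "HOL-Analysis.Analysis"
begin

type_synonym 'a dual = "'a \<Rightarrow>\<^sub>L real"
type_synonym 'a bidual = "'a dual \<Rightarrow>\<^sub>L real"

definition canon :: "'a::real_normed_vector \<Rightarrow> 'a bidual" where
  "canon x = Blinfun (\<lambda>x'. blinfun_apply x' x)"

lemma canon_apply [simp]: "blinfun_apply (canon x) x' = blinfun_apply x' x"
  unfolding canon_def
  by (subst bounded_linear_Blinfun_apply) (auto intro: bounded_linear_intros)

definition gra :: "('x \<Rightarrow> 'y set) \<Rightarrow> ('x \<times> 'y) set" where
  "gra A = {(x, y). y \<in> A x}"

definition ran :: "('x \<Rightarrow> 'y set) \<Rightarrow> 'y set" where
  "ran A = (\<Union>x. A x)"

definition linear_relation :: "('x::real_vector \<Rightarrow> 'y::real_vector set) \<Rightarrow> bool" where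
  "linear_relation A \<longleftrightarrow> subspace (gra A)"

definition monotone_wrt ::
  "'a::real_normed_vector set \<Rightarrow> 'a dual set \<Rightarrow> ('a \<Rightarrow> 'a dual set) \<Rightarrow> bool" where
  "monotone_wrt U V A \<longleftrightarrow>
     (\<forall>(x, x') \<in> gra A \<inter> U \<times> V. \<forall>(y, y') \<in> gra A \<inter> U \<times> V.
        blinfun_apply (x' - y') (x - y) \<ge> 0)"

definition maximally_monotone_wrt ::
  "'a::real_normed_vector set \<Rightarrow> 'a dual set \<Rightarrow> ('a \<Rightarrow> 'a dual set) \<Rightarrow> bool" where
  "maximally_monotone_wrt U V A \<longleftrightarrow>
     monotone_wrt U V A \<and>
     (\<forall>B. monotone_wrt U V B \<longrightarrow> gra A \<inter> U \<times> V \<subseteq> gra B \<inter> U \<times> V \<longrightarrow>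
        gra A \<inter> U \<times> V = gra B \<inter> U \<times> V)"

abbreviation monotone_op :: "('a::real_normed_vector \<Rightarrow> 'a dual set) \<Rightarrow> bool" where
  "monotone_op \<equiv> monotone_wrt UNIV UNIV"

abbreviation maximally_monotone :: "('a::real_normed_vector \<Rightarrow> 'a dual set) \<Rightarrow> bool" where
  "maximally_monotone \<equiv> maximally_monotone_wrt UNIV UNIV"

definition adjoint_rel ::
  "('a::real_normed_vector \<Rightarrow> 'a dual set) \<Rightarrow> 'a bidual \<Rightarrow> 'a dual set" where
  "adjoint_rel A x'' =
     {x'. \<forall>(a, a') \<in> gra A. blinfun_apply x' a = blinfun_apply x'' a'}"

(* Operators from X** to X* pair as <x*, x**>, so monotone_wrt (from X to X* ) does not apply. *)
definition monotone_bidual ::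
  "('a::real_normed_vector bidual \<Rightarrow> 'a dual set) \<Rightarrow> bool" where
  "monotone_bidual T \<longleftrightarrow>
     (\<forall>(x'', x') \<in> gra T. \<forall>(y'', y') \<in> gra T. blinfun_apply (x'' - y'') (x' - y') \<ge> 0)"

definition directed_set :: "'i set \<Rightarrow> ('i \<Rightarrow> 'i \<Rightarrow> bool) \<Rightarrow> bool" where
  "directed_set I le \<longleftrightarrow>
     I \<noteq> {} \<and>
     (\<forall>i\<in>I. le i i) \<and>
     (\<forall>i\<in>I. \<forall>j\<in>I. \<forall>k\<in>I. le i j \<longrightarrow> le j k \<longrightarrow> le i k) \<and>
     (\<forall>i\<in>I. \<forall>j\<in>I. \<exists>k\<in>I. le i k \<and> le j k)"

definition net_filter :: "'i set \<Rightarrow> ('i \<Rightarrow> 'i \<Rightarrow> bool) \<Rightarrow> 'i filter" where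
  "net_filter I le = (INF i\<in>I. principal {j\<in>I. le i j})"

lemma eventually_net_filter:
  assumes "directed_set I le"
  shows "eventually P (net_filter I le) \<longleftrightarrow> (\<exists>i\<in>I. \<forall>j\<in>I. le i j \<longrightarrow> P j)"
  unfolding net_filter_def
proof (subst eventually_INF_base)
  show "I \<noteq> {}" using assms by (simp add: directed_set_def)
  fix i j assume "i \<in> I" "j \<in> I"
  with assms obtain k where k: "k \<in> I" "le i k" "le j k" unfolding directed_set_def by meson
  have "{l \<in> I. le k l} \<subseteq> {l \<in> I. le i l} \<inter> {l \<in> I. le j l}"
    using assms k \<open>i \<in> I\<close> \<open>j \<in> I\<close> unfolding directed_set_def by blast
  then show "\<exists>x\<in>I. principal {j \<in> I. le x j} \<le> inf (principal {l \<in> I. le i l}) (principal {l \<in> I. le j l})"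
    using k(1) by auto
qed (auto simp: eventually_principal)

(* A bounded net (a, a') in G converging to (x'', x'). On X** = (X* =>_L R), the library's
   strong_operator_topology is the topology of pointwise convergence on X*, i.e. sigma(X**, X* ). *)
definition bounded_net_conv ::
  "('a::real_normed_vector \<times> 'a dual) set \<Rightarrow> 'i set \<Rightarrow> ('i \<Rightarrow> 'i \<Rightarrow> bool) \<Rightarrow>
   ('i \<Rightarrow> 'a) \<Rightarrow> ('i \<Rightarrow> 'a dual) \<Rightarrow> 'a bidual \<Rightarrow> 'a dual \<Rightarrow> bool" where
  "bounded_net_conv G I le a a' x'' x' \<longleftrightarrow>
     directed_set I le \<and>
     (\<forall>i\<in>I. (a i, a' i) \<in> G) \<and>
     bounded ((\<lambda>i. (a i, a' i)) ` I) \<and>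
     limitin strong_operator_topology (\<lambda>i. canon (a i)) x'' (net_filter I le) \<and>
     (a' \<longlongrightarrow> x') (net_filter I le)"

lemma limitin_weak_star_iff:
  fixes f :: "'i \<Rightarrow> 'a::real_normed_vector bidual"
  shows "limitin strong_operator_topology f l F \<longleftrightarrow>
         (\<forall>x'. ((\<lambda>i. blinfun_apply (f i) x') \<longlongrightarrow> blinfun_apply l x') F)"
proof
  assume L: "limitin strong_operator_topology f l F"
  show "\<forall>x'. ((\<lambda>i. blinfun_apply (f i) x') \<longlongrightarrow> blinfun_apply l x') F"
    using continuous_map_limit[OF strong_operator_topology_continuous_evaluation L]
    by (simp add: comp_def)
next
  assume *: "\<forall>x'. ((\<lambda>i. blinfun_apply (f i) x') \<longlongrightarrow> blinfun_apply l x') F"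
  then have "limitin (product_topology (\<lambda>i. euclidean) UNIV)
      (\<lambda>i. blinfun_apply (f i)) (blinfun_apply l) F"
    by (simp add: limitin_componentwise)
  then have "((\<lambda>i. blinfun_apply (f i)) \<longlongrightarrow> blinfun_apply l) F"
    by (simp add: euclidean_product_topology)
  then show "limitin strong_operator_topology f l F"
    unfolding limitin_def strong_operator_topology_topspace
    by (auto simp: strong_operator_topology_def openin_pullback_topology tendsto_def)
qed

(* HOL cannot quantify existentially over the type of index sets. Indices of type (X** x X* ) set
   are as good as any others; see bounded_net_conv_any_index. *)
definition type_D :: "('a::real_normed_vector \<Rightarrow> 'a dual set) \<Rightarrow> bool" where
  "type_D A \<longleftrightarrow>
     (\<forall>x'' x'. (INF (a, a') \<in> gra A. ereal (blinfun_apply (canon a - x'') (a' - x'))) \<ge> 0 \<longrightarrow>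
        (\<exists>(I :: ('a bidual \<times> 'a dual) set set) le a a'.
           bounded_net_conv (gra A) I le a a' x'' x'))"

lemma bounded_net_conv_any_index:
  fixes I :: "'i set" and x'' :: "'a::real_normed_vector bidual"
  assumes "bounded_net_conv G I le a a' x'' x'"
  shows "\<exists>(J :: ('a bidual \<times> 'a dual) set set) le' b b'. bounded_net_conv G J le' b b' x'' x'"
proof -
  let ?T = "prod_topology (strong_operator_topology :: 'a bidual topology)
              (euclidean :: 'a dual topology)"
  let ?F = "net_filter I le"
  define J where "J = {W. openin ?T W \<and> (x'', x') \<in> W}"
  have dir: "directed_set I le" and inG: "\<forall>i\<in>I. (a i, a' i) \<in> G"
    and bd: "bounded ((\<lambda>i. (a i, a' i)) ` I)"
    and lim: "limitin strong_operator_topology (\<lambda>i. canon (a i)) x'' ?F" "(a' \<longlongrightarrow> x') ?F"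
    using assms unfolding bounded_net_conv_def by auto
  have lim2: "limitin ?T (\<lambda>i. (canon (a i), a' i)) (x'', x') ?F"
    using lim by (simp add: limitin_pairwise comp_def)
  have "\<exists>i\<in>I. (canon (a i), a' i) \<in> W" if "W \<in> J" for W
  proof -
    have "eventually (\<lambda>i. (canon (a i), a' i) \<in> W) ?F"
      using lim2 that unfolding limitin_def J_def by blast
    then show ?thesis
      using dir unfolding eventually_net_filter[OF dir] directed_set_def by blast
  qed
  then obtain s where s: "\<And>W. W \<in> J \<Longrightarrow> s W \<in> I \<and> (canon (a (s W)), a' (s W)) \<in> W"
    by metis
  let ?le = "\<lambda>V W :: ('a bidual \<times> 'a dual) set. W \<subseteq> V"
  have top: "topspace ?T \<in> J"
    using openin_topspace[of ?T] by (simp add: J_def strong_operator_topology_topspace)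
  have dirJ: "directed_set J ?le"
    unfolding directed_set_def
  proof (intro conjI ballI)
    show "J \<noteq> {}" using top by blast
    fix V W assume "V \<in> J" "W \<in> J"
    then show "\<exists>k\<in>J. k \<subseteq> V \<and> k \<subseteq> W"
      by (intro bexI[of _ "V \<inter> W"]) (auto simp: J_def)
  qed auto
  have "limitin ?T (\<lambda>W. (canon (a (s W)), a' (s W))) (x'', x') (net_filter J ?le)"
    unfolding limitin_def eventually_net_filter[OF dirJ]
  proof (intro conjI allI impI)
    show "(x'', x') \<in> topspace ?T" using top by (simp add: J_def)
    fix U assume "openin ?T U \<and> (x'', x') \<in> U"
    then have "U \<in> J" by (simp add: J_def)
    then show "\<exists>i\<in>J. \<forall>j\<in>J. j \<subseteq> i \<longrightarrow> (canon (a (s j)), a' (s j)) \<in> U"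
      using s by blast
  qed
  then have "limitin strong_operator_topology (\<lambda>W. canon (a (s W))) x'' (net_filter J ?le)"
    "((\<lambda>W. a' (s W)) \<longlongrightarrow> x') (net_filter J ?le)"
    by (simp_all add: limitin_pairwise comp_def)
  moreover have "bounded ((\<lambda>W. (a (s W), a' (s W))) ` J)"
    by (rule bounded_subset[OF bd]) (use s in auto)
  moreover have "\<forall>W\<in>J. (a (s W), a' (s W)) \<in> G" using s inG by blast
  ultimately have "bounded_net_conv G J ?le (\<lambda>W. a (s W)) (\<lambda>W. a' (s W)) x'' x'"
    using dirJ unfolding bounded_net_conv_def by blast
  then show ?thesis by blast
qed

definition type_NI :: "('a::real_normed_vector \<Rightarrow> 'a dual set) \<Rightarrow> bool" where
  "type_NI A \<longleftrightarrow>
     (\<forall>x'' x'. (SUP (a, a') \<in> gra A.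
          ereal (blinfun_apply x' a + blinfun_apply x'' a' - blinfun_apply a' a))
        \<ge> ereal (blinfun_apply x'' x'))"

definition type_FP :: "('a::real_normed_vector \<Rightarrow> 'a dual set) \<Rightarrow> bool" where
  "type_FP A \<longleftrightarrow>
     (\<forall>V. open V \<and> convex V \<and> V \<inter> ran A \<noteq> {} \<longrightarrow> maximally_monotone_wrt UNIV V A)"

end

theory Submission
  imports Defs
begin

text \<open>
  Write \<open>S\<close> for the graph of \<open>A\<close>. It is a closed subspace of $X \times X^*$ on which the
  quadratic form $q(a, a') = \langle a, a'\rangle$ is nonnegative. The graph of the adjoint is
  also a subspace: it consists of the $(u'', u')$ for which $(u', -u'')$ annihilates \<open>S\<close>. So the
  adjoint is monotone exactly when $\langle u', u''\rangle \ge 0$ on its graph.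

  The main step is that a monotone adjoint makes \<open>A\<close> maximally monotone of type (D). Let
  $(x'', x')$ be monotonically related to \<open>S\<close>, so that $q - \ell$ is bounded below on \<open>S\<close>, where
  $\ell(t, t') = \langle t, x'\rangle + \langle t', x''\rangle$. At an almost minimal point
  $(a, a')$ of $q - \ell$ the first-order condition says that $(x', x'') - (a', a)$ is small as a
  functional on \<open>S\<close>. By Hahn-Banach, $(x', x'') = (a', a) + (v', v'') + (w', w'')$ with
  $(v', v'')$ small and $(w', w'')$ zero on \<open>S\<close>. The point $(-w'', w')$ lies in the graph of the
  adjoint, where the pairing is a nonnegative quadratic form, and the choice of $(x'', x')$ makes
  the value of this form at $(-w'', w')$ small. By Cauchy-Schwarz its polarisation against any fixed
  $(u'', u')$ is small too, and in the limit $\langle u', x''\rangle = \langle x', u''\rangle$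
  (lemma \<open>monotonically_related_imp_annihilates\<close>). Thus $(x'', x')$ lies in the biannihilator of
  \<open>S\<close>. If $x''$ comes from \<open>X\<close>, closedness of \<open>S\<close> puts the point into \<open>S\<close>; this is maximality.
  In general a Helly-Goldstine argument (lemma \<open>helly_approximation\<close>) gives the bounded net that
  type (D) asks for, and it converges in norm in the second component because $x'$ lies in $X^*$
  rather than in $X^{***}$.

  The other implications are shorter. Along a net as in (D) the pairing
  $\langle a - x'', a' - x'\rangle$ tends to 0, so it is not bounded below by a positive number:
  (D) implies (NI). Evaluating (NI) at $(-x'', x')$ for a point $(x'', x')$ of the adjoint leaves
  $\langle x', x''\rangle \ge 0$. For (D) implies (FP), a point $(x, x')$ that is monotonically
  related only to the part of \<open>S\<close> over \<open>V\<close> has a Lagrange multiplier \<open>\<phi>\<close> in $X^{**}$ for the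
  constraint $a' \in V$, and $(x - \phi, x')$ is monotonically related to all of \<open>S\<close>; the net
  from (D) then shows \<open>\<phi> = 0\<close>. Finally, if $\langle x', x''\rangle < 0$ somewhere on the adjoint, then (FP)
  fails for a thin neighbourhood \<open>V\<close> of the segment from 0 to $x'$: on so thin a set $-x''$ can be
  replaced by an element of \<open>X\<close> that agrees with it at $x'$.
\<close>

section \<open>Hahn-Banach: linear functionals below sublinear ones\<close>

definition sublinear :: "('v::real_vector \<Rightarrow> real) \<Rightarrow> bool" where
  "sublinear p \<longleftrightarrow> (\<forall>x y. p (x + y) \<le> p x + p y) \<and> (\<forall>t\<ge>0. \<forall>x. p (t *\<^sub>R x) = t * p x)"

lemma sublinear_add: "sublinear p \<Longrightarrow> p (x + y) \<le> p x + p y"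
  and sublinear_scaleR: "sublinear p \<Longrightarrow> 0 \<le> t \<Longrightarrow> p (t *\<^sub>R x) = t * p x"
  by (auto simp: sublinear_def)

lemma sublinear_zero: "sublinear p \<Longrightarrow> p 0 = 0"
  using sublinear_scaleR[of p 0 0] by simp

lemma sublinear_ge_neg: "sublinear p \<Longrightarrow> - p (- x) \<le> p x"
  using sublinear_add[of p x "- x"] sublinear_zero[of p] by simp

lemma sublinear_scaleR_le:
  fixes p :: "'v::real_vector \<Rightarrow> real"
  assumes le: "\<And>t x. 0 < t \<Longrightarrow> p (t *\<^sub>R x) \<le> t * p x" and t: "0 < t"
  shows "p (t *\<^sub>R x) = t * p x"
proof (rule antisym[OF le[OF t]])
  have "p ((1 / t) *\<^sub>R (t *\<^sub>R x)) \<le> 1 / t * p (t *\<^sub>R x)" using t by (intro le) simp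
  then show "t * p x \<le> p (t *\<^sub>R x)" using t by (simp add: field_simps)
qed

lemma diff_le_swap: "a - b \<le> c \<Longrightarrow> a - c \<le> (b::real)"
  by simp

text \<open>
  Minimal sublinear functionals are found by Zorn's lemma, and the infimum of a chain is its lower
  bound. It is finite because every sublinear \<open>q \<le> p\<close> satisfies \<open>- p (- x) \<le> q x\<close>; it is subadditive
  because two members of a chain have a common smaller member.
\<close>
lemma sublinear_INF_chain:
  fixes p :: "'v::real_vector \<Rightarrow> real"
  assumes ne: "C \<noteq> {}" and sub: "\<And>q. q \<in> C \<Longrightarrow> sublinear q \<and> q \<le> p"
    and chain: "\<And>q r. q \<in> C \<Longrightarrow> r \<in> C \<Longrightarrow> q \<le> r \<or> r \<le> q"
  shows "sublinear (\<lambda>x. INF q\<in>C. q x)" and "\<And>q x. q \<in> C \<Longrightarrow> (INF q\<in>C. q x) \<le> q x"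
proof -
  have bdd: "bdd_below ((\<lambda>q. q x) ` C)" for x
  proof (rule bdd_belowI2[where m = "- p (- x)"])
    fix q assume "q \<in> C"
    then have "sublinear q" "q (- x) \<le> p (- x)" using sub by (auto simp: le_fun_def)
    then show "- p (- x) \<le> q x" using sublinear_ge_neg[of q x] by simp
  qed
  show low: "(INF q\<in>C. q x) \<le> q x" if "q \<in> C" for q x
    using that bdd by (rule cINF_lower[rotated])
  let ?u = "\<lambda>x. INF q\<in>C. q x"
  have add: "?u (x + y) \<le> ?u x + ?u y" for x y
  proof -
    have 1: "?u (x + y) \<le> q x + r y" if "q \<in> C" "r \<in> C" for q r
    proof -
      have "\<exists>s\<in>C. s \<le> q \<and> s \<le> r" using chain[OF that] that by blast
      then obtain s where s: "s \<in> C" "s \<le> q" "s \<le> r" by blast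
      have "?u (x + y) \<le> s (x + y)" using low[OF s(1)] .
      also have "\<dots> \<le> s x + s y" using sub[OF s(1)] sublinear_add by blast
      also have "\<dots> \<le> q x + r y" using s by (intro add_mono) (auto simp: le_fun_def)
      finally show ?thesis .
    qed
    have sw: "?u (x + y) - q x \<le> ?u y" if "q \<in> C" for q
      using 1[OF that] ne by (intro cINF_greatest) (auto simp: diff_le_eq add.commute)
    have "?u (x + y) - ?u y \<le> q x" if "q \<in> C" for q
      by (rule diff_le_swap[OF sw[OF that]])
    then have "?u (x + y) - ?u y \<le> ?u x" using ne by (intro cINF_greatest) auto
    then show ?thesis by simp
  qed
  have scale_le: "?u (t *\<^sub>R x) \<le> t * ?u x" if t: "0 < t" for t x
  proof -
    have "?u (t *\<^sub>R x) / t \<le> q x" if "q \<in> C" for q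
      using low[OF that, of "t *\<^sub>R x"] sublinear_scaleR[of q t x] sub[OF that] t
      by (simp add: field_simps)
    then have "?u (t *\<^sub>R x) / t \<le> ?u x" using ne by (intro cINF_greatest) auto
    then show ?thesis using t by (simp add: field_simps)
  qed
  have zero: "?u 0 = 0"
  proof -
    have "(\<lambda>q. q 0) ` C = {0}" using ne sub sublinear_zero by force
    then show ?thesis by simp
  qed
  have scale: "?u (t *\<^sub>R x) = t * ?u x" if t: "0 \<le> t" for t x
    using sublinear_scaleR_le[of ?u, OF scale_le] zero t by (cases "t = 0") auto
  show "sublinear ?u" unfolding sublinear_def using add scale by blast
qed

lemma minimal_sublinear_below:
  fixes p :: "'v::real_vector \<Rightarrow> real"
  assumes "sublinear p"
  obtains q where "sublinear q" "q \<le> p" "\<And>r. sublinear r \<Longrightarrow> r \<le> q \<Longrightarrow> r = q"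
proof -
  let ?A = "{q. sublinear q \<and> q \<le> p}" and ?P = "\<lambda>q r :: 'v \<Rightarrow> real. r \<le> q"
  have "\<exists>m\<in>?A. \<forall>a\<in>?A. ?P m a \<longrightarrow> a = m"
  proof (rule predicate_Zorn)
    show "partial_order_on ?A (relation_of ?P ?A)"
      by (rule partial_order_on_relation_ofI) auto
  next
    fix C assume C: "C \<in> Chains (relation_of ?P ?A)"
    have sub: "sublinear q \<and> q \<le> p" if "q \<in> C" for q
      using C that unfolding Chains_def relation_of_def by blast
    have ch: "q \<le> r \<or> r \<le> q" if "q \<in> C" "r \<in> C" for q r
      using C that unfolding Chains_def relation_of_def by blast
    show "\<exists>u\<in>?A. \<forall>a\<in>C. ?P a u"
    proof (cases "C = {}")
      case True
      then show ?thesis using assms by blast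
    next
      case False
      let ?u = "\<lambda>x. INF q\<in>C. q x"
      have u1: "sublinear ?u" by (rule sublinear_INF_chain(1)[OF False]) (fact sub, fact ch)
      have u2: "?u x \<le> q x" if "q \<in> C" for q x
        by (rule sublinear_INF_chain(2)[OF False _ _ that]) (fact sub, fact ch)
      obtain q where q: "q \<in> C" using False by blast
      have "?u \<le> q" using u2[OF q] by (simp add: le_fun_def)
      then have "?u \<in> ?A" using u1 sub[OF q] by auto
      then show ?thesis using u2 by (intro bexI[of _ ?u]) (auto simp: le_fun_def)
    qed
  qed
  then obtain m where m: "sublinear m" "m \<le> p"
    and min: "\<And>a. sublinear a \<Longrightarrow> a \<le> p \<Longrightarrow> a \<le> m \<Longrightarrow> a = m" by blast
  show thesis
  proof (rule that[OF m])
    fix r assume "sublinear r" "r \<le> m"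
    then show "r = m" using m(2) by (intro min) (auto intro: order_trans)
  qed
qed

text \<open>
  A minimal sublinear functional \<open>q\<close> is linear: for fixed \<open>y\<close>, the infimum of \<open>q (x + t y) - t q y\<close>
  over \<open>t \<ge> 0\<close> is sublinear in \<open>x\<close> and at most \<open>q\<close>, so it equals \<open>q\<close>, and \<open>t = 1\<close> gives superadditivity.
\<close>
lemma sublinear_dominates_linear:
  fixes p :: "'v::real_vector \<Rightarrow> real"
  assumes "sublinear p"
  obtains f where "linear f" "f \<le> p"
proof -
  obtain q where q: "sublinear q" "q \<le> p" and min: "\<And>r. sublinear r \<Longrightarrow> r \<le> q \<Longrightarrow> r = q"
    using minimal_sublinear_below[OF assms] by blast
  have super: "q x + q y \<le> q (x + y)" for x y
  proof -
    let ?B = "\<lambda>x. (\<lambda>t. q (x + t *\<^sub>R y) - t * q y) ` {0..}"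
    let ?r = "\<lambda>x. Inf (?B x)"
    have ne: "?B x \<noteq> {}" for x by auto
    have bdd: "bdd_below (?B x)" for x
    proof (rule bdd_belowI2[where m = "- q (- x)"])
      fix t :: real assume "t \<in> {0..}"
      then have "t * q y \<le> q (x + t *\<^sub>R y) + q (- x)"
        using sublinear_add[OF q(1), of "x + t *\<^sub>R y" "- x"] sublinear_scaleR[OF q(1), of t y] by simp
      then show "- q (- x) \<le> q (x + t *\<^sub>R y) - t * q y" by simp
    qed
    have low: "?r x \<le> q (x + t *\<^sub>R y) - t * q y" if "0 \<le> t" for x t
      using that bdd by (intro cInf_lower) auto
    have great: "c \<le> ?r x" if "\<And>t. 0 \<le> t \<Longrightarrow> c \<le> q (x + t *\<^sub>R y) - t * q y" for c x
      using that by (intro cInf_greatest) auto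
    have rq: "?r \<le> q" using low[of 0] by (simp add: le_fun_def)
    have add: "?r (x + z) \<le> ?r x + ?r z" for x z
    proof -
      have 1: "?r (x + z) \<le> (q (x + s *\<^sub>R y) - s * q y) + (q (z + t *\<^sub>R y) - t * q y)"
        if "0 \<le> s" "0 \<le> t" for s t
      proof -
        have "?r (x + z) \<le> q ((x + z) + (s + t) *\<^sub>R y) - (s + t) * q y"
          using that by (intro low) simp
        moreover have "q ((x + z) + (s + t) *\<^sub>R y) \<le> q (x + s *\<^sub>R y) + q (z + t *\<^sub>R y)"
          using sublinear_add[OF q(1), of "x + s *\<^sub>R y" "z + t *\<^sub>R y"] by (simp add: algebra_simps)
        ultimately show ?thesis unfolding distrib_right by linarith
      qed
      have sw: "?r (x + z) - (q (x + s *\<^sub>R y) - s * q y) \<le> ?r z" if "0 \<le> s" for s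
        by (rule great) (use 1[OF that] in \<open>simp only: diff_le_eq add.commute\<close>)
      have "?r (x + z) - ?r z \<le> q (x + s *\<^sub>R y) - s * q y" if "0 \<le> s" for s
        by (rule diff_le_swap[OF sw[OF that]])
      then have "?r (x + z) - ?r z \<le> ?r x" by (rule great)
      then show ?thesis by simp
    qed
    have scale_le: "?r (s *\<^sub>R x) \<le> s * ?r x" if s: "0 < s" for s x
    proof -
      have "?r (s *\<^sub>R x) / s \<le> ?r x"
      proof (rule great)
        fix t :: real assume t: "0 \<le> t"
        have "?r (s *\<^sub>R x) \<le> q (s *\<^sub>R x + (s * t) *\<^sub>R y) - s * t * q y"
          using s t by (intro low) simp
        also have "\<dots> = s * (q (x + t *\<^sub>R y) - t * q y)"
          using sublinear_scaleR[OF q(1), of s "x + t *\<^sub>R y"] s by (simp add: algebra_simps)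
        finally show "?r (s *\<^sub>R x) / s \<le> q (x + t *\<^sub>R y) - t * q y"
          using s by (simp add: field_simps)
      qed
      then show ?thesis using s by (simp add: field_simps)
    qed
    have zero: "?r 0 = 0"
    proof (rule antisym)
      show "?r 0 \<le> 0" using low[of 0 0] sublinear_zero[OF q(1)] by simp
      show "0 \<le> ?r 0" by (rule great) (simp add: sublinear_scaleR[OF q(1)])
    qed
    have "?r (s *\<^sub>R x) = s * ?r x" if "0 \<le> s" for s x
      using sublinear_scaleR_le[of ?r, OF scale_le] zero that by (cases "s = 0") auto
    then have "sublinear ?r" using add unfolding sublinear_def by blast
    then have "?r = q" using rq by (rule min)
    then have "q x \<le> q (x + 1 *\<^sub>R y) - 1 * q y" using low[of 1 x] by (simp only: fun_eq_iff zero_le_one)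
    then show ?thesis by simp
  qed
  have add: "q (x + y) = q x + q y" for x y
    using super sublinear_add[OF q(1)] by (intro antisym)
  have neg: "q (- x) = - q x" for x
    using add[of x "- x"] sublinear_zero[OF q(1)] by simp
  have "q (t *\<^sub>R x) = t * q x" for t x
  proof (cases "0 \<le> t")
    case True
    then show ?thesis by (rule sublinear_scaleR[OF q(1)])
  next
    case False
    then show ?thesis using sublinear_scaleR[OF q(1), of "- t" x] neg[of "t *\<^sub>R x"] by simp
  qed
  then have "linear q" using add by (intro linearI) auto
  then show thesis using q(2) that by blast
qed

text \<open>
  This is the geometric form of Hahn-Banach from which all separations below are read off. The
  gauge-like functional that sends \<open>y\<close> to the infimum of the \<open>s * r\<close> with \<open>(y / s, r) \<in> G\<close> is sublinear:
  convexity of \<open>G\<close> makes it subadditive, the absorbing property keeps it below infinity, and the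
  condition over 0 keeps it above minus infinity.
\<close>
lemma linear_minorant_of_convex_set:
  fixes G :: "('v::real_vector \<times> real) set"
  assumes conv: "convex G"
    and absorb: "\<And>y. \<exists>t>0. \<exists>r. (t *\<^sub>R y, r) \<in> G"
    and zero: "\<And>r. (0, r) \<in> G \<Longrightarrow> 0 \<le> r"
  obtains f where "linear f" "\<And>y r. (y, r) \<in> G \<Longrightarrow> f y \<le> r"
proof -
  let ?B = "\<lambda>y. {s * r | s r z. 0 < s \<and> (z, r) \<in> G \<and> y = s *\<^sub>R z}"
  let ?p = "\<lambda>y. Inf (?B y)"
  have mem: "a \<in> ?B y" if "0 < s" "(z, r) \<in> G" "y = s *\<^sub>R z" "a = s * r" for a s r y z
    using that by blast
  have comb: "\<exists>u z r. 0 < u \<and> (z, r) \<in> G \<and> x + y = u *\<^sub>R z \<and> a + b = u * r"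
    if ab: "a \<in> ?B x" "b \<in> ?B y" for a b x y
  proof -
    obtain s r z t r' z' where *: "0 < s" "(z, r) \<in> G" "x = s *\<^sub>R z" "a = s * r"
      "0 < t" "(z', r') \<in> G" "y = t *\<^sub>R z'" "b = t * r'" using ab by blast
    have "(s / (s + t)) *\<^sub>R (z, r) + (t / (s + t)) *\<^sub>R (z', r') \<in> G"
      using * by (intro convexD[OF conv]) (auto simp: add_divide_distrib[symmetric])
    then have "((s / (s + t)) *\<^sub>R z + (t / (s + t)) *\<^sub>R z', s / (s + t) * r + t / (s + t) * r') \<in> G"
      by simp
    moreover have "x + y = (s + t) *\<^sub>R ((s / (s + t)) *\<^sub>R z + (t / (s + t)) *\<^sub>R z')"
      using * by (simp add: scaleR_add_right)
    moreover have "a + b = (s + t) * (s / (s + t) * r + t / (s + t) * r')"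
      using * by (simp add: distrib_left)
    ultimately show ?thesis using * by (meson add_pos_pos)
  qed
  have ne: "?B y \<noteq> {}" for y
  proof -
    obtain t r where t: "0 < t" "(t *\<^sub>R y, r) \<in> G" using absorb by blast
    then have "1 / t * r \<in> ?B y" by (intro mem[of "1 / t" "t *\<^sub>R y" r]) auto
    then show ?thesis by blast
  qed
  have nonneg: "0 \<le> a + b" if "a \<in> ?B y" "b \<in> ?B (- y)" for a b y
    using comb[OF that] zero by fastforce
  have bdd: "bdd_below (?B y)" for y
  proof -
    obtain b where "b \<in> ?B (- y)" using ne by blast
    then have "- b \<le> a" if "a \<in> ?B y" for a using nonneg[OF that] by fastforce
    then show ?thesis by (rule bdd_belowI)
  qed
  have low: "?p y \<le> a" if "a \<in> ?B y" for a y using that bdd by (rule cInf_lower)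
  have add: "?p (x + y) \<le> ?p x + ?p y" for x y
  proof -
    have 1: "?p (x + y) \<le> a + b" if "a \<in> ?B x" "b \<in> ?B y" for a b
      using comb[OF that] by (intro low) auto
    have sw: "?p (x + y) - a \<le> ?p y" if "a \<in> ?B x" for a
      using 1[OF that] by (intro cInf_greatest[OF ne]) (simp only: diff_le_eq add.commute)
    have "?p (x + y) - ?p y \<le> a" if "a \<in> ?B x" for a
      by (rule diff_le_swap[OF sw[OF that]])
    then have "?p (x + y) - ?p y \<le> ?p x" by (intro cInf_greatest[OF ne])
    then show ?thesis by simp
  qed
  have scale_le: "?p (t *\<^sub>R y) \<le> t * ?p y" if t: "0 < t" for t y
  proof -
    have "?p (t *\<^sub>R y) / t \<le> ?p y"
    proof (rule cInf_greatest[OF ne])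
      fix a assume "a \<in> ?B y"
      then obtain s r z where *: "0 < s" "(z, r) \<in> G" "y = s *\<^sub>R z" "a = s * r" by blast
      have "t * a \<in> ?B (t *\<^sub>R y)"
        using * t by (intro mem[of "t * s" z r]) auto
      then have "?p (t *\<^sub>R y) \<le> t * a" by (rule low)
      then show "?p (t *\<^sub>R y) / t \<le> a" using t by (simp add: field_simps)
    qed
    then show ?thesis using t by (simp add: field_simps)
  qed
  have zero': "?p 0 = 0"
  proof (rule antisym)
    show "0 \<le> ?p 0" by (rule cInf_greatest[OF ne]) (auto simp: zero)
    have "?p 0 \<le> 2 * ?p 0" using add[of 0 0] by simp
    moreover have "?p 0 \<le> 1 / 2 * ?p 0" using scale_le[of "1 / 2" 0] by simp
    ultimately show "?p 0 \<le> 0" by simp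
  qed
  have "?p (s *\<^sub>R x) = s * ?p x" if "0 \<le> s" for s x
    using sublinear_scaleR_le[of ?p, OF scale_le] zero' that by (cases "s = 0") auto
  then have "sublinear ?p" using add unfolding sublinear_def by blast
  then obtain f where f: "linear f" "f \<le> ?p" by (rule sublinear_dominates_linear)
  have "f y \<le> r" if "(y, r) \<in> G" for y r
  proof -
    have "r \<in> ?B y" using that by (intro mem[of 1 y r]) auto
    then show ?thesis using f(2) low[of r y] by (auto simp: le_fun_def intro: order_trans)
  qed
  then show thesis using f(1) that by blast
qed

lemma sublinear_norm: "sublinear (\<lambda>x::'v::real_normed_vector. K * norm x)" if "0 \<le> K"
  using that unfolding sublinear_def
  by (auto simp: distrib_left[symmetric] intro!: mult_left_mono norm_triangle_ineq)

text \<open>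
  A sandwich theorem for a sublinear \<open>N\<close> and a concave function given by its hypograph \<open>K\<close>. It is
  obtained as a linear minorant of the function that sends \<open>y\<close> to the infimum of \<open>N (y + k) - e\<close> over
  \<open>(k, e) \<in> K\<close>: the pair \<open>(0, 0)\<close> gives \<open>f \<le> N\<close>, and \<open>y = - k\<close> gives \<open>e \<le> f k\<close>.
\<close>
lemma linear_between_convex_and_sublinear:
  fixes N :: "'v::real_vector \<Rightarrow> real"
  assumes N: "sublinear N" and K: "convex K" "(0, 0) \<in> K"
    and le: "\<And>k e. (k, e) \<in> K \<Longrightarrow> e \<le> N k"
  obtains f where "linear f" "\<And>y. f y \<le> N y" "\<And>k e. (k, e) \<in> K \<Longrightarrow> e \<le> f k"
proof -
  let ?G = "{(y, r). \<exists>(k, e)\<in>K. N (y + k) - e \<le> r}"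
  have "convex ?G"
  proof (rule convexI)
    fix g1 g2 :: "'v \<times> real" and \<alpha> \<beta> :: real
    assume g: "g1 \<in> ?G" "g2 \<in> ?G" and ab: "0 \<le> \<alpha>" "0 \<le> \<beta>" "\<alpha> + \<beta> = 1"
    obtain y1 r1 k1 e1 y2 r2 k2 e2 where
      g12: "g1 = (y1, r1)" "g2 = (y2, r2)" and k: "(k1, e1) \<in> K" "(k2, e2) \<in> K"
      and r: "N (y1 + k1) - e1 \<le> r1" "N (y2 + k2) - e2 \<le> r2"
      using g by fast
    have mem: "(\<alpha> *\<^sub>R k1 + \<beta> *\<^sub>R k2, \<alpha> * e1 + \<beta> * e2) \<in> K"
      using convexD[OF K(1) k ab] by simp
    have "N (\<alpha> *\<^sub>R y1 + \<beta> *\<^sub>R y2 + (\<alpha> *\<^sub>R k1 + \<beta> *\<^sub>R k2))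
        = N (\<alpha> *\<^sub>R (y1 + k1) + \<beta> *\<^sub>R (y2 + k2))" by (simp add: algebra_simps)
    also have "\<dots> \<le> \<alpha> * N (y1 + k1) + \<beta> * N (y2 + k2)"
      using sublinear_add[OF N] sublinear_scaleR[OF N] ab by metis
    also have "\<dots> \<le> \<alpha> * (r1 + e1) + \<beta> * (r2 + e2)"
      using r ab by (intro add_mono mult_left_mono) auto
    finally have "N (\<alpha> *\<^sub>R y1 + \<beta> *\<^sub>R y2 + (\<alpha> *\<^sub>R k1 + \<beta> *\<^sub>R k2)) - (\<alpha> * e1 + \<beta> * e2)
        \<le> \<alpha> *\<^sub>R r1 + \<beta> *\<^sub>R r2" by (simp add: algebra_simps)
    then show "\<alpha> *\<^sub>R g1 + \<beta> *\<^sub>R g2 \<in> ?G" using mem unfolding g12 by auto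
  qed
  moreover have "\<exists>t>0. \<exists>r. (t *\<^sub>R y, r) \<in> ?G" for y
    using K(2) by (intro exI[of _ 1] conjI exI[of _ "N y"]) (auto intro!: bexI[of _ "(0, 0)"])
  moreover have "0 \<le> r" if "(0, r) \<in> ?G" for r
    using that le by fastforce
  ultimately obtain f where f: "linear f" "\<And>y r. (y, r) \<in> ?G \<Longrightarrow> f y \<le> r"
    using linear_minorant_of_convex_set[of ?G] by blast
  show thesis
  proof (rule that[OF f(1)])
    show "f y \<le> N y" for y
      using K(2) by (intro f(2)) (auto intro!: bexI[of _ "(0, 0)"])
    show "e \<le> f k" if "(k, e) \<in> K" for k e
    proof -
      have "f (- k) \<le> - e"
        using that sublinear_zero[OF N] by (intro f(2)) (auto intro!: bexI[of _ "(k, e)"])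
      then show ?thesis using linear_neg[OF f(1), of k] by simp
    qed
  qed
qed

lemma hahn_banach_subspace:
  fixes f :: "'v::real_vector \<Rightarrow> real"
  assumes N: "sublinear N" and S: "subspace S" and f: "linear f"
    and le: "\<And>s. s \<in> S \<Longrightarrow> f s \<le> N s"
  obtains g where "linear g" "\<And>y. g y \<le> N y" "\<And>s. s \<in> S \<Longrightarrow> g s = f s"
proof -
  interpret f: linear f by (rule f)
  let ?K = "(\<lambda>s. (s, f s)) ` S"
  have lin: "linear (\<lambda>s. (s, f s))"
    by (rule linearI) (simp_all add: f.add f.scale)
  have K: "convex ?K" "(0, 0) \<in> ?K"
    using S lin by (auto intro!: subspace_imp_convex linear_subspace_image image_eqI[of _ _ 0]
        simp: f.zero subspace_0)
  obtain g where g: "linear g" "\<And>y. g y \<le> N y" "\<And>k e. (k, e) \<in> ?K \<Longrightarrow> e \<le> g k"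
    using linear_between_convex_and_sublinear[OF N K] le by blast
  have ge: "f s \<le> g s" if "s \<in> S" for s using that by (intro g(3)) auto
  have "g s = f s" if "s \<in> S" for s
    using ge[OF that] ge[OF subspace_neg[OF S that]] linear_neg[OF g(1), of s] f.neg[of s] by simp
  then show thesis using g that by blast
qed

lemma separate_from_sublinear_ball:
  fixes N :: "'v::real_vector \<Rightarrow> real"
  assumes N: "sublinear N" and C: "convex C" "C \<noteq> {}"
    and far: "\<And>c. c \<in> C \<Longrightarrow> \<epsilon> \<le> N c"
  obtains f where "linear f" "\<And>y. f y \<le> N y" "\<And>c. c \<in> C \<Longrightarrow> \<epsilon> \<le> f c"
proof -
  let ?K = "cone hull (C \<times> {\<epsilon>})"
  have expl: "?K = {t *\<^sub>R x | t x. 0 \<le> t \<and> x \<in> C \<times> {\<epsilon>}}" by (rule cone_hull_expl)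
  have K: "convex ?K" using C(1) by (intro convex_cone_hull convex_Times) auto
  have K0: "(0, 0) \<in> ?K"
  proof -
    obtain c where "c \<in> C" using C(2) by blast
    then have "0 *\<^sub>R (c, \<epsilon>) \<in> ?K" unfolding expl by blast
    then show ?thesis by (simp add: zero_prod_def)
  qed
  have le: "e \<le> N k" if "(k, e) \<in> ?K" for k e
    using that far unfolding expl by (auto simp: sublinear_scaleR[OF N] intro!: mult_left_mono)
  obtain f where f: "linear f" "\<And>y. f y \<le> N y" "\<And>k e. (k, e) \<in> ?K \<Longrightarrow> e \<le> f k"
    using linear_between_convex_and_sublinear[OF N K K0 le] by blast
  have "\<epsilon> \<le> f c" if "c \<in> C" for c
    using that by (intro f(3)) (auto intro!: hull_inc)
  then show thesis using f that by blast
qed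

lemma blinfun_of_dominated_linear:
  fixes f :: "'v::real_normed_vector \<Rightarrow> real"
  assumes f: "linear f" and le: "\<And>y. f y \<le> K * norm y" and K: "0 \<le> K"
  obtains g :: "'v dual" where "\<And>y. blinfun_apply g y = f y" "norm g \<le> K"
proof -
  have abs: "\<bar>f y\<bar> \<le> K * norm y" for y
    using le[of y] le[of "- y"] linear_neg[OF f, of y] by (simp add: abs_le_iff)
  then have "bounded_linear f"
    using f by (intro bounded_linear.intro) (auto simp: bounded_linear_axioms_def mult.commute)
  then have app: "blinfun_apply (Blinfun f) y = f y" for y by (simp add: bounded_linear_Blinfun_apply)
  have "norm (Blinfun f) \<le> K"
    using K abs by (intro norm_blinfun_bound) (auto simp: app)
  then show thesis using app that by blast
qed

text \<open>
  By induction on \<open>F\<close>: if some \<open>u\<close> vanishes on \<open>F\<close> but not at \<open>f\<close>, a multiple of the evaluation at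
  \<open>f\<close> is subtracted from \<open>\<phi>\<close> so that the rest depends on the values on \<open>F\<close> only; otherwise \<open>f\<close> is
  redundant. The lemma brings a separating functional on $X^{**}$ back to an element of $X^*$.
\<close>
lemma linear_on_dual_eq_evaluation:
  fixes \<phi> :: "'v::real_normed_vector dual \<Rightarrow> real"
  assumes "finite F" "linear \<phi>"
    and "\<And>u. (\<And>f. f \<in> F \<Longrightarrow> blinfun_apply u f = 0) \<Longrightarrow> \<phi> u = 0"
  shows "\<exists>g. \<forall>u. \<phi> u = blinfun_apply u g"
  using assms
proof (induction F arbitrary: \<phi> rule: finite_induct)
  case empty
  then show ?case by (auto intro!: exI[of _ 0])
next
  case (insert f F)
  interpret \<phi>: linear \<phi> by (rule insert.prems(1))
  show ?case
  proof (cases "\<exists>u::'v dual. (\<forall>h\<in>F. blinfun_apply u h = 0) \<and> blinfun_apply u f \<noteq> 0")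
    case False
    have "\<phi> u = 0" if u: "\<And>h. h \<in> F \<Longrightarrow> blinfun_apply u h = 0" for u
    proof (rule insert.prems(2))
      have "blinfun_apply u f = 0" using u False by metis
      then show "blinfun_apply u h = 0" if "h \<in> insert f F" for h
        using that u by (cases "h = f") simp_all
    qed
    with insert.prems(1) show ?thesis by (rule insert.IH)
  next
    case True
    then obtain u :: "'v dual" where u: "\<And>h. h \<in> F \<Longrightarrow> blinfun_apply u h = 0" "blinfun_apply u f \<noteq> 0" by blast
    let ?c = "\<phi> u / blinfun_apply u f"
    have "\<exists>g. \<forall>w. \<phi> w - ?c * blinfun_apply w f = blinfun_apply w g"
    proof (rule insert.IH)
      show "linear (\<lambda>w. \<phi> w - ?c * blinfun_apply w f)"
        by (rule linearI) (simp_all add: \<phi>.add \<phi>.scale blinfun.add_left blinfun.scaleR_left algebra_simps)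
      fix w :: "'v dual"
      assume w: "\<And>h. h \<in> F \<Longrightarrow> blinfun_apply w h = 0"
      have "\<phi> (w - (blinfun_apply w f / blinfun_apply u f) *\<^sub>R u) = 0"
        using u w by (intro insert.prems(2)) (auto simp: blinfun.diff_left blinfun.scaleR_left)
      then show "\<phi> w - ?c * blinfun_apply w f = 0" by (simp add: \<phi>.diff \<phi>.scale mult.commute)
    qed
    then obtain g where g: "\<And>w. \<phi> w - ?c * blinfun_apply w f = blinfun_apply w g" by blast
    have "\<phi> w = blinfun_apply w (g + ?c *\<^sub>R f)" for w
      using g[of w] by (simp add: blinfun.add_right blinfun.scaleR_right)
    then show ?thesis by blast
  qed
qed

section \<open>Points of the biannihilator of a subspace of the product of a space and its dual\<close>

lemma eq_zero_of_multiples_bounded_below: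
  fixes L c :: real
  assumes "\<And>t. c \<le> t * L"
  shows "L = 0"
proof (rule ccontr)
  assume "L \<noteq> 0"
  then show False using assms[of "(c - 1) / L"] by simp
qed

text \<open>
  The hypothesis says that $(x'', x')$ lies in the biannihilator of \<open>S\<close>. A separation argument of Helly type
  shows that it can be approximated from \<open>S\<close>: weakly* in the first component, in norm in the second, and
  with the norm of the first component under control. The bound on $a$ is encoded by a third
  coordinate $a - b$ with $b$ in the ball of radius $\|x''\|$, so that one separation in
  $X^{**} \times X^* \times X$ treats all three requirements. The separating functional is then a triple
  $(g, \psi, h)$ with $(g + h, \psi)$ zero on \<open>S\<close>, and the hypothesis turns the separation into
  $\|h\| \|x''\| < \langle h, x''\rangle$, which is absurd.
\<close>
lemma helly_approximation:
  fixes S :: "('a::real_normed_vector \<times> 'a dual) set" and x'' :: "'a bidual" and x' :: "'a dual"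
  assumes S: "subspace S"
    and ann: "\<And>u'' u'. (\<And>a a'. (a, a') \<in> S \<Longrightarrow> blinfun_apply u' a = blinfun_apply u'' a') \<Longrightarrow>
      blinfun_apply x'' u' = blinfun_apply u'' x'"
    and F: "finite F" and \<epsilon>: "0 < \<epsilon>"
  obtains a a' where "(a, a') \<in> S" "norm a < norm x'' + \<epsilon>" "norm (a' - x') < \<epsilon>"
    "\<And>f. f \<in> F \<Longrightarrow> \<bar>blinfun_apply f a - blinfun_apply x'' f\<bar> < \<epsilon>"
proof (rule ccontr)
  note found = that
  assume no: "\<not> thesis"
  define N :: "'a bidual \<times> 'a dual \<times> 'a \<Rightarrow> real"
    where "N = (\<lambda>(u, v, w). (\<Sum>f\<in>F. \<bar>blinfun_apply u f\<bar>) + norm v + norm w)"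
  define C :: "('a bidual \<times> 'a dual \<times> 'a) set"
    where "C = {(canon a - x'', a' - x', a - b) | a a' b. (a, a') \<in> S \<and> norm b \<le> norm x''}"
  have N: "sublinear N"
    unfolding sublinear_def
  proof (intro conjI allI impI)
    fix y z :: "'a bidual \<times> 'a dual \<times> 'a"
    obtain u v w u2 v2 w2 where yz: "y = (u, v, w)" "z = (u2, v2, w2)" by (metis prod.exhaust)
    have "(\<Sum>f\<in>F. \<bar>blinfun_apply (u + u2) f\<bar>)
        \<le> (\<Sum>f\<in>F. \<bar>blinfun_apply u f\<bar>) + (\<Sum>f\<in>F. \<bar>blinfun_apply u2 f\<bar>)"
      unfolding sum.distrib[symmetric] by (intro sum_mono) (simp add: blinfun.add_left)
    moreover have "norm (v + v2) \<le> norm v + norm v2" "norm (w + w2) \<le> norm w + norm w2"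
      by (rule norm_triangle_ineq)+
    ultimately show "N (y + z) \<le> N y + N z" unfolding N_def yz by simp
  next
    fix t :: real and y :: "'a bidual \<times> 'a dual \<times> 'a"
    assume "0 \<le> t"
    then show "N (t *\<^sub>R y) = t * N y"
      unfolding N_def
      by (cases y) (simp add: blinfun.scaleR_left abs_mult sum_distrib_left[symmetric] distrib_left)
  qed
  have "convex C"
  proof (rule convexI)
    fix y z and \<alpha> \<beta> :: real
    assume yz: "y \<in> C" "z \<in> C" and ab: "0 \<le> \<alpha>" "0 \<le> \<beta>" "\<alpha> + \<beta> = 1"
    obtain a a' b c c' d where
      y: "y = (canon a - x'', a' - x', a - b)" "(a, a') \<in> S" "norm b \<le> norm x''" and
      z: "z = (canon c - x'', c' - x', c - d)" "(c, c') \<in> S" "norm d \<le> norm x''"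
      using yz unfolding C_def by blast
    have \<beta>: "\<beta> = 1 - \<alpha>" using ab by simp
    have canon: "canon (\<alpha> *\<^sub>R a + \<beta> *\<^sub>R c) = \<alpha> *\<^sub>R canon a + \<beta> *\<^sub>R canon c"
      by (rule blinfun_eqI) (simp add: blinfun.add_left blinfun.scaleR_left blinfun.add_right blinfun.scaleR_right)
    have "\<alpha> *\<^sub>R (a, a') + \<beta> *\<^sub>R (c, c') \<in> S"
      using y z by (intro subspace_add[OF S] subspace_scale[OF S])
    then have mem: "(\<alpha> *\<^sub>R a + \<beta> *\<^sub>R c, \<alpha> *\<^sub>R a' + \<beta> *\<^sub>R c') \<in> S" by simp
    have "norm (\<alpha> *\<^sub>R b + \<beta> *\<^sub>R d) \<le> norm x''"
      using convexD[OF convex_cball[of 0 "norm x''"], of b d \<alpha> \<beta>] y z ab by simp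
    moreover have "\<alpha> *\<^sub>R y + \<beta> *\<^sub>R z = (canon (\<alpha> *\<^sub>R a + \<beta> *\<^sub>R c) - x'',
        (\<alpha> *\<^sub>R a' + \<beta> *\<^sub>R c') - x', (\<alpha> *\<^sub>R a + \<beta> *\<^sub>R c) - (\<alpha> *\<^sub>R b + \<beta> *\<^sub>R d))"
      unfolding canon y z unfolding \<beta> by (simp add: algebra_simps)
    ultimately show "\<alpha> *\<^sub>R y + \<beta> *\<^sub>R z \<in> C" using mem unfolding C_def by blast
  qed
  moreover have "C \<noteq> {}"
    using subspace_0[OF S] unfolding C_def zero_prod_def by (auto intro!: exI[of _ 0])
  moreover have "\<epsilon> \<le> N c" if cC: "c \<in> C" for c
  proof (rule ccontr)
    assume *: "\<not> \<epsilon> \<le> N c"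
    obtain a a' b where c: "c = (canon a - x'', a' - x', a - b)" "(a, a') \<in> S" "norm b \<le> norm x''"
      using cC unfolding C_def by blast
    have lt: "(\<Sum>f\<in>F. \<bar>blinfun_apply (canon a - x'') f\<bar>) + norm (a' - x') + norm (a - b) < \<epsilon>"
      using * unfolding c N_def by simp
    have nn: "0 \<le> (\<Sum>f\<in>F. \<bar>blinfun_apply (canon a - x'') f\<bar>)" by (simp add: sum_nonneg)
    have "\<bar>blinfun_apply f a - blinfun_apply x'' f\<bar> < \<epsilon>" if "f \<in> F" for f
    proof -
      have "\<bar>blinfun_apply (canon a - x'') f\<bar> \<le> (\<Sum>f\<in>F. \<bar>blinfun_apply (canon a - x'') f\<bar>)"
        using that F by (intro member_le_sum) auto
      then have "\<bar>blinfun_apply (canon a - x'') f\<bar> < \<epsilon>"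
        using lt norm_ge_zero[of "a' - x'"] norm_ge_zero[of "a - b"] by linarith
      then show ?thesis by (simp add: blinfun.diff_left)
    qed
    moreover have "norm a < norm x'' + \<epsilon>"
      using norm_triangle_ineq[of b "a - b"] lt nn c(3) norm_ge_zero[of "a' - x'"]
      by (simp only: add.commute[of b] diff_add_cancel)
    moreover have "norm (a' - x') < \<epsilon>" using lt nn norm_ge_zero[of "a - b"] by linarith
    ultimately show False using no found[OF c(2)] by blast
  qed
  ultimately obtain \<phi> where \<phi>: "linear \<phi>" "\<And>y. \<phi> y \<le> N y" "\<And>c. c \<in> C \<Longrightarrow> \<epsilon> \<le> \<phi> c"
    using separate_from_sublinear_ball[OF N] by blast
  interpret \<phi>: linear \<phi> by (rule \<phi>(1))
  have split: "\<phi> (u, v, w) = \<phi> (u, 0, 0) + \<phi> (0, v, 0) + \<phi> (0, 0, w)" for u v w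
    unfolding \<phi>.add[symmetric] by simp
  have lin1: "linear (\<lambda>u. \<phi> (u, 0, 0))" and lin2: "linear (\<lambda>v. \<phi> (0, v, 0))"
    and lin3: "linear (\<lambda>w. \<phi> (0, 0, w))"
    by (rule linear_compose[OF linearI \<phi>(1), unfolded comp_def]; simp)+
  have "\<phi> (u, 0, 0) = 0" if "\<And>f. f \<in> F \<Longrightarrow> blinfun_apply u f = 0" for u
    using \<phi>(2)[of "(u, 0, 0)"] \<phi>(2)[of "(- u, 0, 0)"] \<phi>.neg[of "(u, 0, 0)"] that
    by (simp add: N_def blinfun.minus_left)
  then obtain g where g: "\<And>u. \<phi> (u, 0, 0) = blinfun_apply u g"
    using linear_on_dual_eq_evaluation[OF F lin1] by blast
  have le2: "\<phi> (0, v, 0) \<le> 1 * norm v" and le3: "\<phi> (0, 0, w) \<le> 1 * norm w" for v w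
    using \<phi>(2)[of "(0, v, 0)"] \<phi>(2)[of "(0, 0, w)"] by (simp_all add: N_def)
  obtain \<psi> :: "'a bidual" where \<psi>: "\<And>v. blinfun_apply \<psi> v = \<phi> (0, v, 0)"
    using blinfun_of_dominated_linear[OF lin2 le2 zero_le_one] by blast
  obtain h :: "'a dual" where h: "\<And>w. blinfun_apply h w = \<phi> (0, 0, w)"
    using blinfun_of_dominated_linear[OF lin3 le3 zero_le_one] by blast
  have ineq: "\<epsilon> \<le> (blinfun_apply (g + h) a + blinfun_apply \<psi> a')
      - blinfun_apply x'' g - blinfun_apply \<psi> x' - blinfun_apply h b"
    if "(a, a') \<in> S" "norm b \<le> norm x''" for a a' b
  proof -
    have "(canon a - x'', a' - x', a - b) \<in> C" using that unfolding C_def by blast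
    from \<phi>(3)[OF this] show ?thesis
      unfolding split[of "canon a - x''"] g \<psi>[symmetric] h[symmetric]
      by (simp add: blinfun.diff_left blinfun.diff_right blinfun.add_left)
  qed
  \<comment> \<open>The pair \<open>(a, a')\<close> can be scaled freely while \<open>b = 0\<close> stays fixed, so the linear part vanishes on \<open>S\<close>.\<close>
  have "blinfun_apply (g + h) a = blinfun_apply (- \<psi>) a'" if "(a, a') \<in> S" for a a'
  proof -
    let ?L = "blinfun_apply (g + h) a + blinfun_apply \<psi> a'"
    have "\<epsilon> + blinfun_apply x'' g + blinfun_apply \<psi> x' \<le> t * ?L" for t
    proof -
      have "(t *\<^sub>R a, t *\<^sub>R a') \<in> S" using subspace_scale[OF S that, of t] by simp
      from ineq[OF this, of 0] show ?thesis
        by (simp add: blinfun.scaleR_right distrib_left blinfun.zero_right)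
    qed
    then have "?L = 0" by (rule eq_zero_of_multiples_bounded_below)
    then show ?thesis by (simp add: blinfun.minus_left)
  qed
  then have "blinfun_apply x'' (g + h) = blinfun_apply (- \<psi>) x'" by (rule ann)
  then have hb: "blinfun_apply h b \<le> blinfun_apply x'' h - \<epsilon>" if "norm b \<le> norm x''" for b
    using ineq[of 0 0 b] that subspace_0[OF S]
    by (simp add: zero_prod_def blinfun.minus_left blinfun.add_right blinfun.zero_right)
  \<comment> \<open>Taking the supremum of \<open>h b\<close> over the ball; the ball is a point when \<open>x'' = 0\<close>.\<close>
  have "norm h * norm x'' \<le> blinfun_apply x'' h - \<epsilon>"
  proof (cases "norm x'' = 0")
    case True
    then show ?thesis using hb[of 0] by (simp add: blinfun.zero_right)
  next
    case False
    then have pos: "0 < norm x''" by simp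
    have nn: "0 \<le> blinfun_apply x'' h - \<epsilon>" using hb[of 0] by (simp add: blinfun.zero_right)
    have "norm (blinfun_apply h y) \<le> ((blinfun_apply x'' h - \<epsilon>) / norm x'') * norm y" for y
    proof (cases "y = 0")
      case False
      let ?b = "(norm x'' / norm y) *\<^sub>R y"
      have "norm ?b \<le> norm x''" "norm (- ?b) \<le> norm x''" using False by auto
      from hb[OF this(1)] hb[OF this(2)] show ?thesis
        using False pos by (simp add: blinfun.scaleR_right blinfun.minus_right field_simps abs_le_iff)
    qed (simp add: blinfun.zero_right)
    then have "norm h \<le> (blinfun_apply x'' h - \<epsilon>) / norm x''"
      using nn by (intro norm_blinfun_bound) auto
    then show ?thesis using pos by (simp add: field_simps)
  qed
  moreover have "blinfun_apply x'' h \<le> norm x'' * norm h"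
    using norm_blinfun[of x'' h] by simp
  ultimately show False using \<epsilon> by (simp add: mult.commute)
qed

section \<open>Monotonically related points when the adjoint is monotone\<close>

text \<open>
  Maximality can be tested one point at a time, since adding a single monotonically related point to
  the graph keeps the operator monotone.
\<close>
lemma maximally_monotone_wrt_iff:
  "maximally_monotone_wrt U V A \<longleftrightarrow>
     monotone_wrt U V A \<and>
     (\<forall>x\<in>U. \<forall>x'\<in>V. (\<forall>(a, a')\<in>gra A \<inter> U \<times> V. 0 \<le> blinfun_apply (x' - a') (x - a)) \<longrightarrow> x' \<in> A x)"
    (is "?L \<longleftrightarrow> ?M \<and> ?R")
proof
  assume L: ?L
  then have M: ?M by (simp add: maximally_monotone_wrt_def)
  moreover have ?R
  proof (intro ballI impI)
    fix x x' assume x: "x \<in> U" "x' \<in> V"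
      and rel: "\<forall>(a, a')\<in>gra A \<inter> U \<times> V. 0 \<le> blinfun_apply (x' - a') (x - a)"
    let ?B = "\<lambda>y. if y = x then insert x' (A y) else A y"
    have graB: "gra ?B = insert (x, x') (gra A)" by (auto simp: gra_def split: if_splits)
    have rel': "0 \<le> blinfun_apply (a' - x') (a - x)" if "(a, a') \<in> gra A \<inter> U \<times> V" for a a'
    proof -
      have "blinfun_apply (a' - x') (a - x) = blinfun_apply (x' - a') (x - a)"
        by (simp add: blinfun.diff_left blinfun.diff_right)
      then show ?thesis using rel that by auto
    qed
    have "monotone_wrt U V ?B"
      unfolding monotone_wrt_def graB case_prod_beta
    proof (intro ballI)
      fix p q
      assume "p \<in> insert (x, x') (gra A) \<inter> U \<times> V" "q \<in> insert (x, x') (gra A) \<inter> U \<times> V"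
      then consider "p = (x, x')" "q = (x, x')"
        | "p = (x, x')" "q \<in> gra A \<inter> U \<times> V" | "p \<in> gra A \<inter> U \<times> V" "q = (x, x')"
        | "p \<in> gra A \<inter> U \<times> V" "q \<in> gra A \<inter> U \<times> V" by blast
      then show "0 \<le> blinfun_apply (snd p - snd q) (fst p - fst q)"
      proof cases
        case 4
        then show ?thesis using M unfolding monotone_wrt_def case_prod_beta by blast
      qed (use rel rel'[of "fst p" "snd p"] in \<open>auto simp: case_prod_beta\<close>)
    qed
    then have "gra A \<inter> U \<times> V = gra ?B \<inter> U \<times> V"
      using L graB unfolding maximally_monotone_wrt_def by blast
    then have "(x, x') \<in> gra A" using x graB by blast
    then show "x' \<in> A x" by (simp add: gra_def)
  qed
  ultimately show "?M \<and> ?R" ..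
next
  assume R: "?M \<and> ?R"
  show ?L
    unfolding maximally_monotone_wrt_def
  proof (intro conjI allI impI)
    show ?M using R ..
    fix B assume B: "monotone_wrt U V B" "gra A \<inter> U \<times> V \<subseteq> gra B \<inter> U \<times> V"
    have "(x, x') \<in> gra A" if "(x, x') \<in> gra B" "x \<in> U" "x' \<in> V" for x x'
    proof -
      have "0 \<le> blinfun_apply (x' - a') (x - a)" if "(a, a') \<in> gra A \<inter> U \<times> V" for a a'
        using B \<open>(x, x') \<in> gra B\<close> \<open>x \<in> U\<close> \<open>x' \<in> V\<close> that unfolding monotone_wrt_def by fast
      then have "\<forall>(a, a')\<in>gra A \<inter> U \<times> V. 0 \<le> blinfun_apply (x' - a') (x - a)" by blast
      then have "x' \<in> A x" using R that by blast
      then show ?thesis by (simp add: gra_def)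
    qed
    then show "gra A \<inter> U \<times> V = gra B \<inter> U \<times> V" using B(2) by blast
  qed
qed

text \<open>
  The relation to \<open>S\<close> bounds $q - \ell$ below by $-\langle x', x''\rangle$ on \<open>S\<close>. At a point within $\eta^2$ of the
  infimum, a step of length $\eta$ in the direction $(t, t')$ cannot lower $q - \ell$ by more than $\eta^2$;
  dividing by $\eta$ gives the first-order condition, in a form that uses $q(t, t')$ instead of the norm.
\<close>
lemma exists_almost_minimizer:
  fixes S :: "('a::real_normed_vector \<times> 'a dual) set" and x' :: "'a dual" and x'' :: "'a bidual"
  assumes S: "subspace S"
    and rel: "\<And>a a'. (a, a') \<in> S \<Longrightarrow> 0 \<le> blinfun_apply (canon a - x'') (a' - x')"
    and \<eta>: "0 < \<eta>"
  obtains a a' where "(a, a') \<in> S"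
    "\<And>t t'. (t, t') \<in> S \<Longrightarrow> blinfun_apply (x' - a') t + blinfun_apply (x'' - canon a) t'
      \<le> \<eta> * (1 + blinfun_apply t' t)"
proof -
  define E where "E = (\<lambda>(a, a'). blinfun_apply a' a - blinfun_apply x' a - blinfun_apply x'' a')"
  have "- blinfun_apply x'' x' \<le> E s" if "s \<in> S" for s
    using rel[of "fst s" "snd s"] that
    by (simp add: E_def case_prod_beta blinfun.diff_left blinfun.diff_right)
  then have bdd: "bdd_below (E ` S)" by (rule bdd_belowI2)
  have "S \<noteq> {}" using subspace_0[OF S] by blast
  then obtain s where s: "s \<in> S" "E s < Inf (E ` S) + \<eta>\<^sup>2"
    using cInf_lessD[of "E ` S" "Inf (E ` S) + \<eta>\<^sup>2"] \<eta> by auto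
  obtain a a' where aa: "s = (a, a')" by (cases s)
  show thesis
  proof (rule that)
    show "(a, a') \<in> S" using s aa by simp
    fix t t' assume t: "(t, t') \<in> S"
    have "s + \<eta> *\<^sub>R (t, t') \<in> S" using s t by (intro subspace_add[OF S] subspace_scale[OF S])
    then have "E s - \<eta>\<^sup>2 \<le> E (s + \<eta> *\<^sub>R (t, t'))"
      using s(2) cInf_lower[OF _ bdd, of "E (s + \<eta> *\<^sub>R (t, t'))"] by fastforce
    then have "\<eta> * (blinfun_apply (x' - a') t + blinfun_apply (x'' - canon a) t')
        \<le> \<eta> * (\<eta> * (1 + blinfun_apply t' t))"
      unfolding aa E_def
      by (simp add: blinfun.diff_left blinfun.add_left blinfun.add_right blinfun.scaleR_left
          blinfun.scaleR_right algebra_simps power2_eq_square)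
    then show "blinfun_apply (x' - a') t + blinfun_apply (x'' - canon a) t'
        \<le> \<eta> * (1 + blinfun_apply t' t)" using \<eta> by simp
  qed
qed

text \<open>
  Since $q(t, t') \le 1$ on the unit sphere, the first-order condition makes the restriction of
  $(r', r'')$ to \<open>S\<close> a functional of norm at most $2\eta$, which Hahn-Banach extends without increasing this bound.
\<close>
lemma small_blinfuns_extending_on_subspace:
  fixes S :: "('a::real_normed_vector \<times> 'a dual) set" and r' :: "'a dual" and r'' :: "'a bidual"
  assumes S: "subspace S" and \<eta>: "0 \<le> \<eta>"
    and le: "\<And>t t'. (t, t') \<in> S \<Longrightarrow> blinfun_apply r' t + blinfun_apply r'' t'
      \<le> \<eta> * (1 + blinfun_apply t' t)"
  obtains v' :: "'a dual" and v'' :: "'a bidual" where "norm v' \<le> 2 * \<eta>" "norm v'' \<le> 2 * \<eta>"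
    "\<And>t t'. (t, t') \<in> S \<Longrightarrow> blinfun_apply v' t + blinfun_apply v'' t'
      = blinfun_apply r' t + blinfun_apply r'' t'"
proof -
  define f where "f = (\<lambda>(t, t'). blinfun_apply r' t + blinfun_apply r'' t')"
  have f: "linear f"
    by (rule linearI) (auto simp: f_def blinfun.add_right blinfun.scaleR_right algebra_simps)
  have bound: "f y \<le> 2 * \<eta> * norm y" if y: "y \<in> S" for y
  proof (cases "y = 0")
    case False
    obtain e e' where e: "(1 / norm y) *\<^sub>R y = (e, e')" by (cases "(1 / norm y) *\<^sub>R y")
    then have mem: "(e, e') \<in> S" using subspace_scale[OF S y] by metis
    have "norm (e, e') = 1" unfolding e[symmetric] using False by simp
    then have n: "norm e \<le> 1" "norm e' \<le> 1"
      using norm_fst_le[of e e'] norm_snd_le[of e' e] by simp_all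
    have "norm e' * norm e \<le> 1" by (rule mult_le_one[OF n(2) norm_ge_zero n(1)])
    then have "blinfun_apply e' e \<le> 1" using norm_blinfun[of e' e] by simp
    then have "\<eta> * (1 + blinfun_apply e' e) \<le> \<eta> * 2"
      using \<eta> by (intro mult_left_mono) auto
    then have "f ((1 / norm y) *\<^sub>R y) \<le> 2 * \<eta>"
      using le[OF mem] by (simp add: f_def e)
    then show ?thesis
      using False linear_scale[OF f, of "1 / norm y" y] by (simp add: field_simps)
  qed (simp add: linear_0[OF f])
  obtain g where g: "linear g" "\<And>y. g y \<le> 2 * \<eta> * norm y" "\<And>s. s \<in> S \<Longrightarrow> g s = f s"
    using hahn_banach_subspace[OF sublinear_norm[of "2 * \<eta>"] S f bound] \<eta> by auto
  interpret g: linear g by (rule g(1))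
  have lin: "linear (\<lambda>t. g (t, 0))" "linear (\<lambda>t'. g (0, t'))"
    by (rule linear_compose[OF linearI g(1), unfolded comp_def]; simp)+
  have le': "g (t, 0) \<le> 2 * \<eta> * norm t" and le'': "g (0, t') \<le> 2 * \<eta> * norm t'"
    and nn: "0 \<le> 2 * \<eta>" for t t'
    using g(2)[of "(t, 0)"] g(2)[of "(0, t')"] \<eta> by simp_all
  obtain v' :: "'a dual" where v': "\<And>t. blinfun_apply v' t = g (t, 0)" "norm v' \<le> 2 * \<eta>"
    using blinfun_of_dominated_linear[OF lin(1) le' nn] by blast
  obtain v'' :: "'a bidual" where v'': "\<And>t. blinfun_apply v'' t = g (0, t)" "norm v'' \<le> 2 * \<eta>"
    using blinfun_of_dominated_linear[OF lin(2) le'' nn] by blast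
  have "blinfun_apply v' t + blinfun_apply v'' t' = blinfun_apply r' t + blinfun_apply r'' t'"
    if "(t, t') \<in> S" for t t'
    using g(3)[OF that] by (simp add: v' v'' g.add[symmetric] f_def)
  then show thesis using v'(2) v''(2) that by blast
qed

lemma linear_coefficient_zero_of_quadratic_nonneg:
  fixes d Q :: real
  assumes "\<And>\<tau>. 0 \<le> \<tau> * d + \<tau>\<^sup>2 * Q"
  shows "d = 0"
proof -
  have Q: "0 \<le> Q" using assms[of 1] assms[of "-1"] by simp
  define e where "e = d / (Q + 1)"
  have d: "d = e * (Q + 1)" using Q by (simp add: e_def)
  have "0 \<le> - e * d + (- e)\<^sup>2 * Q" by (rule assms)
  also have "\<dots> = - e\<^sup>2" unfolding d by (simp add: algebra_simps power2_eq_square)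
  finally have "e = 0" by simp
  then show ?thesis by (simp add: d)
qed

lemma nonneg_of_small_errors:
  fixes c K :: real
  assumes "\<And>\<eta>. 0 < \<eta> \<Longrightarrow> \<eta> \<le> 1 / 2 \<Longrightarrow> 0 \<le> c + \<eta> * K"
  shows "0 \<le> c"
proof (rule tendsto_lowerbound)
  have "((\<lambda>\<eta>. c + \<eta> * K) \<longlongrightarrow> c + 0 * K) (at_right 0)" by (intro tendsto_intros)
  then show "((\<lambda>\<eta>. c + \<eta> * K) \<longlongrightarrow> c) (at_right 0)" by simp
  show "\<forall>\<^sub>F \<eta> in at_right 0. 0 \<le> c + \<eta> * K"
    using assms by (auto intro!: eventually_at_rightI[of 0 "1 / 2"])
qed simp

text \<open>
  The core of the proof. With the decomposition $(x', x'') = (a', a) + (v', v'') + (w', w'')$, monotonicity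
  of the adjoint is applied to $(\tau u'' - w'', \tau u' + w')$ for real $\tau$. As $\eta$ tends to 0 the terms with
  $v$ vanish, and so does $-\langle w', w''\rangle$. What remains is $\tau d + \tau^2 Q \ge 0$ for every $\tau$, with
  $d = \langle x', u''\rangle - \langle u', x''\rangle$; this forces $d = 0$.
\<close>
lemma monotonically_related_imp_annihilates:
  fixes S :: "('a::real_normed_vector \<times> 'a dual) set" and x' :: "'a dual" and x'' :: "'a bidual"
  assumes S: "subspace S" and mono: "\<And>a a'. (a, a') \<in> S \<Longrightarrow> 0 \<le> blinfun_apply a' a"
    and adj: "\<And>u'' u'. (\<And>a a'. (a, a') \<in> S \<Longrightarrow> blinfun_apply u' a = blinfun_apply u'' a') \<Longrightarrow>
      0 \<le> blinfun_apply u'' u'"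
    and rel: "\<And>a a'. (a, a') \<in> S \<Longrightarrow> 0 \<le> blinfun_apply (canon a - x'') (a' - x')"
    and u: "\<And>a a'. (a, a') \<in> S \<Longrightarrow> blinfun_apply u' a = blinfun_apply u'' a'"
  shows "blinfun_apply x'' u' = blinfun_apply u'' x'"
proof -
  define c where "c = blinfun_apply x'' x'"
  define d where "d = blinfun_apply u'' x' - blinfun_apply x'' u'"
  define Q where "Q = blinfun_apply u'' u'"
  have "0 \<le> \<tau> * d + \<tau>\<^sup>2 * Q" for \<tau>
  proof (rule nonneg_of_small_errors)
    let ?K = "4 + 2 * c + 2 * norm x' + 2 * norm x'' + 2 * \<bar>\<tau>\<bar> * (norm u' + norm u'')"
    fix \<eta> :: real assume \<eta>: "0 < \<eta>" "\<eta> \<le> 1 / 2"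
    obtain a a' where a: "(a, a') \<in> S" and
      near: "\<And>t t'. (t, t') \<in> S \<Longrightarrow> blinfun_apply (x' - a') t + blinfun_apply (x'' - canon a) t'
        \<le> \<eta> * (1 + blinfun_apply t' t)"
      using exists_almost_minimizer[OF S rel \<eta>(1)] by blast
    obtain v' v'' where v: "norm v' \<le> 2 * \<eta>" "norm v'' \<le> 2 * \<eta>" and
      veq: "\<And>t t'. (t, t') \<in> S \<Longrightarrow> blinfun_apply v' t + blinfun_apply v'' t'
        = blinfun_apply (x' - a') t + blinfun_apply (x'' - canon a) t'"
      using small_blinfuns_extending_on_subspace[OF S _ near] \<eta> by auto
    define w' where "w' = x' - a' - v'"
    define w'' where "w'' = x'' - canon a - v''"
    have w: "blinfun_apply w' t + blinfun_apply w'' t' = 0" if "(t, t') \<in> S" for t t'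
      using veq[OF that] by (simp add: w'_def w''_def blinfun.diff_left)
    define q where "q = blinfun_apply a' a"
    define s where "s = blinfun_apply v' a + blinfun_apply v'' a'"
    have s_eq: "s = blinfun_apply x' a + blinfun_apply x'' a' - 2 * q"
      using veq[OF a] by (simp add: s_def q_def blinfun.diff_left)
    \<comment> \<open>The estimate at \<open>- (a, a')\<close> uses \<open>q\<close> rather than the norm of \<open>(a, a')\<close>, for which there is no bound.\<close>
    have neg_s: "- s \<le> \<eta> * (1 + q)"
    proof -
      have "(- a, - a') \<in> S" using subspace_neg[OF S a] by simp
      from near[OF this] veq[OF a] show ?thesis
        by (simp add: s_def q_def blinfun.minus_right blinfun.minus_left)
    qed
    have qc: "q - c \<le> - s"
      using rel[OF a] by (simp add: s_eq q_def c_def blinfun.diff_left blinfun.diff_right)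
    have q_bound: "q \<le> 2 * c + 1"
    proof -
      have "\<eta> * (1 + q) \<le> 1 / 2 * (1 + q)"
        using \<eta> mono[OF a] by (intro mult_right_mono) (auto simp: q_def)
      then show ?thesis using qc neg_s by simp
    qed
    have "q - c \<le> \<eta> * (1 + q)" using qc neg_s by simp
    also have "\<dots> \<le> \<eta> * (2 + 2 * c)" using \<eta> q_bound by (intro mult_left_mono) auto
    finally have qc': "q - c \<le> \<eta> * (2 + 2 * c)" .
    have bounds: "blinfun_apply v'' y \<le> 2 * \<eta> * norm y" "- blinfun_apply v'' y \<le> 2 * \<eta> * norm y"
      "blinfun_apply z v' \<le> 2 * \<eta> * norm z" "- blinfun_apply z v' \<le> 2 * \<eta> * norm z"
      for y :: "'a dual" and z :: "'a bidual"
    proof -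
      have "\<bar>blinfun_apply v'' y\<bar> \<le> 2 * \<eta> * norm y"
        using norm_blinfun[of v'' y] mult_right_mono[OF v(2) norm_ge_zero[of y]] by simp
      moreover have "\<bar>blinfun_apply z v'\<bar> \<le> 2 * \<eta> * norm z"
        using norm_blinfun[of z v'] mult_left_mono[OF v(1) norm_ge_zero[of z]]
        by (simp add: mult.commute)
      ultimately show "blinfun_apply v'' y \<le> 2 * \<eta> * norm y" "- blinfun_apply v'' y \<le> 2 * \<eta> * norm y"
        "blinfun_apply z v' \<le> 2 * \<eta> * norm z" "- blinfun_apply z v' \<le> 2 * \<eta> * norm z" by simp_all
    qed
    have "2 * \<eta> * norm v' \<le> 2 * \<eta> * 1" using \<eta> v by (intro mult_left_mono) auto
    then have vv: "- blinfun_apply v'' v' \<le> 2 * \<eta>" using bounds(2)[of v'] by simp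
    \<comment> \<open>Expand the pairing of \<open>x' - v' = a' + w'\<close> with \<open>x'' - v'' = a + w''\<close>; the mixed terms vanish
       as \<open>w\<close> annihilates \<open>S\<close>.\<close>
    have "- blinfun_apply w'' w' = q - c + blinfun_apply v'' x' + blinfun_apply x'' v' - blinfun_apply v'' v'"
      using s_eq by (simp add: w'_def w''_def q_def c_def s_def blinfun.diff_left blinfun.diff_right)
    then have P: "- blinfun_apply w'' w' \<le> \<eta> * (4 + 2 * c + 2 * norm x' + 2 * norm x'')"
      using qc' vv bounds(1)[of x'] bounds(3)[of x''] by (simp add: algebra_simps)
    have "0 \<le> blinfun_apply (\<tau> *\<^sub>R u'' - w'') (\<tau> *\<^sub>R u' + w')"
    proof (rule adj)
      fix t t' assume "(t, t') \<in> S"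
      from w[OF this] u[OF this] show "blinfun_apply (\<tau> *\<^sub>R u' + w') t = blinfun_apply (\<tau> *\<^sub>R u'' - w'') t'"
        by (simp add: blinfun.add_left blinfun.diff_left blinfun.scaleR_left)
    qed
    also have "\<dots> = - blinfun_apply w'' w' + \<tau> * d
        + \<tau> * (blinfun_apply v'' u' - blinfun_apply u'' v') + \<tau>\<^sup>2 * Q"
      using u[OF a]
      by (simp add: w'_def w''_def d_def Q_def blinfun.diff_left blinfun.diff_right blinfun.add_left
          blinfun.add_right blinfun.scaleR_left blinfun.scaleR_right algebra_simps power2_eq_square)
    also have "\<tau> * (blinfun_apply v'' u' - blinfun_apply u'' v')
        \<le> \<bar>\<tau>\<bar> * \<bar>blinfun_apply v'' u' - blinfun_apply u'' v'\<bar>"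
      unfolding abs_mult[symmetric] by (rule abs_ge_self)
    also have "\<dots> \<le> \<bar>\<tau>\<bar> * (2 * \<eta> * norm u' + 2 * \<eta> * norm u'')"
      using bounds(1,2)[of u'] bounds(3,4)[of u''] by (intro mult_left_mono) (auto simp: abs_le_iff)
    finally have "0 \<le> - blinfun_apply w'' w' + \<tau> * d
        + \<bar>\<tau>\<bar> * (2 * \<eta> * norm u' + 2 * \<eta> * norm u'') + \<tau>\<^sup>2 * Q" by simp
    then show "0 \<le> \<tau> * d + \<tau>\<^sup>2 * Q + \<eta> * ?K" using P by (simp add: algebra_simps)
  qed
  then have "d = 0" by (rule linear_coefficient_zero_of_quadratic_nonneg)
  then show ?thesis by (simp add: d_def)
qed

section \<open>Type (D), closedness and type (NI)\<close>

text \<open>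
  The net is indexed by a finite set \<open>F\<close> of test functionals and a natural number \<open>n\<close> with tolerance
  \<open>1 / (n + 1)\<close>, and takes its values from the Helly approximation.
\<close>
lemma bounded_net_of_annihilator:
  fixes S :: "('a::real_normed_vector \<times> 'a dual) set" and x'' :: "'a bidual" and x' :: "'a dual"
  assumes S: "subspace S"
    and ann: "\<And>u'' u'. (\<And>a a'. (a, a') \<in> S \<Longrightarrow> blinfun_apply u' a = blinfun_apply u'' a') \<Longrightarrow>
      blinfun_apply x'' u' = blinfun_apply u'' x'"
  shows "\<exists>(I :: ('a dual set \<times> nat) set) le a a'. bounded_net_conv S I le a a' x'' x'"
proof -
  define I :: "('a dual set \<times> nat) set" where "I = {(F, n). finite F}"
  define le :: "('a dual set \<times> nat) \<Rightarrow> ('a dual set \<times> nat) \<Rightarrow> bool"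
    where "le = (\<lambda>(F, m) (G, n). F \<subseteq> G \<and> m \<le> n)"
  define \<epsilon> :: "'a dual set \<times> nat \<Rightarrow> real" where "\<epsilon> = (\<lambda>(F, n). 1 / real (Suc n))"
  have pos: "0 < \<epsilon> i" and le1: "\<epsilon> i \<le> 1" for i by (auto simp: \<epsilon>_def split: prod.splits)
  have "\<exists>s\<in>S. norm (fst s) < norm x'' + \<epsilon> i \<and> norm (snd s - x') < \<epsilon> i \<and>
      (\<forall>f\<in>fst i. \<bar>blinfun_apply f (fst s) - blinfun_apply x'' f\<bar> < \<epsilon> i)" if "i \<in> I" for i
  proof -
    have "finite (fst i)" using that by (auto simp: I_def)
    then obtain a a' where "(a, a') \<in> S" "norm a < norm x'' + \<epsilon> i" "norm (a' - x') < \<epsilon> i"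
      "\<And>f. f \<in> fst i \<Longrightarrow> \<bar>blinfun_apply f a - blinfun_apply x'' f\<bar> < \<epsilon> i"
      using helly_approximation[OF S ann _ pos] by blast
    then show ?thesis by (intro bexI[of _ "(a, a')"]) auto
  qed
  then obtain s where s: "\<And>i. i \<in> I \<Longrightarrow> s i \<in> S"
    "\<And>i. i \<in> I \<Longrightarrow> norm (fst (s i)) < norm x'' + \<epsilon> i"
    "\<And>i. i \<in> I \<Longrightarrow> norm (snd (s i) - x') < \<epsilon> i"
    "\<And>i f. i \<in> I \<Longrightarrow> f \<in> fst i \<Longrightarrow> \<bar>blinfun_apply f (fst (s i)) - blinfun_apply x'' f\<bar> < \<epsilon> i"
    by metis
  have dir: "directed_set I le"
    unfolding directed_set_def
  proof (intro conjI ballI impI)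
    have "({}, 0) \<in> I" by (simp add: I_def)
    then show "I \<noteq> {}" by blast
    fix i j assume ij: "i \<in> I" "j \<in> I"
    show "le i i" by (auto simp: le_def)
    show "\<exists>k\<in>I. le i k \<and> le j k"
      using ij by (intro bexI[of _ "(fst i \<union> fst j, max (snd i) (snd j))"])
        (auto simp: I_def le_def split: prod.splits)
    fix k assume "k \<in> I" "le i j" "le j k"
    then show "le i k" by (auto simp: le_def split: prod.splits)
  qed
  have small: "\<exists>n0. \<forall>i\<in>I. le ({}, n0) i \<longrightarrow> \<epsilon> i < e" if e: "0 < e" for e
  proof -
    obtain n0 where n0: "inverse (real (Suc n0)) < e" using reals_Archimedean[OF e] by blast
    have "\<epsilon> i < e" if "le ({}, n0) i" for i
    proof -
      have "\<epsilon> i \<le> inverse (real (Suc n0))"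
        using that by (auto simp: \<epsilon>_def le_def field_simps split: prod.splits)
      then show ?thesis using n0 by simp
    qed
    then show ?thesis by blast
  qed
  have lim1: "((\<lambda>i. blinfun_apply (canon (fst (s i))) f) \<longlongrightarrow> blinfun_apply x'' f) (net_filter I le)" for f
  proof (rule tendstoI)
    fix e :: real assume "0 < e"
    then obtain n0 where n0: "\<forall>i\<in>I. le ({}, n0) i \<longrightarrow> \<epsilon> i < e" using small by blast
    have mem: "({f}, n0) \<in> I" by (simp add: I_def)
    have "\<forall>i\<in>{j \<in> I. le ({f}, n0) j}. dist (blinfun_apply (canon (fst (s i))) f) (blinfun_apply x'' f) < e"
    proof
      fix i assume i: "i \<in> {j \<in> I. le ({f}, n0) j}"
      then have "le ({}, n0) i" "f \<in> fst i" by (auto simp: le_def split: prod.splits)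
      then show "dist (blinfun_apply (canon (fst (s i))) f) (blinfun_apply x'' f) < e"
        using s(4)[of i f] i n0 by (force simp: dist_real_def)
    qed
    then show "\<forall>\<^sub>F i in net_filter I le. dist (blinfun_apply (canon (fst (s i))) f) (blinfun_apply x'' f) < e"
      unfolding eventually_net_filter[OF dir] using mem by blast
  qed
  have lim2: "((\<lambda>i. snd (s i)) \<longlongrightarrow> x') (net_filter I le)"
  proof (rule tendstoI)
    fix e :: real assume "0 < e"
    then obtain n0 where n0: "\<forall>i\<in>I. le ({}, n0) i \<longrightarrow> \<epsilon> i < e" using small by blast
    have "({}, n0) \<in> I" by (simp add: I_def)
    then show "\<forall>\<^sub>F i in net_filter I le. dist (snd (s i)) x' < e"
      unfolding eventually_net_filter[OF dir] using s(3) n0 by (force simp: dist_norm)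
  qed
  have bd: "bounded ((\<lambda>i. (fst (s i), snd (s i))) ` I)"
  proof (rule boundedI)
    fix y assume "y \<in> (\<lambda>i. (fst (s i), snd (s i))) ` I"
    then obtain i where i: "i \<in> I" "y = s i" by auto
    have "norm (snd (s i)) \<le> norm x' + 1"
      using norm_triangle_ineq2[of "snd (s i)" x'] s(3)[OF i(1)] le1[of i] by linarith
    moreover have "norm (fst (s i)) \<le> norm x'' + 1"
      using s(2)[OF i(1)] le1[of i] by linarith
    moreover have "norm y \<le> norm (fst (s i)) + norm (snd (s i))"
      using norm_Pair_le[of "fst (s i)" "snd (s i)"] i by simp
    ultimately show "norm y \<le> (norm x'' + 1) + (norm x' + 1)" by linarith
  qed
  have "bounded_net_conv S I le (\<lambda>i. fst (s i)) (\<lambda>i. snd (s i)) x'' x'"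
    unfolding bounded_net_conv_def limitin_weak_star_iff
    using dir s(1) bd lim1 lim2 by simp
  then show ?thesis by blast
qed

text \<open>
  If a ball around $(x, x')$ misses \<open>S\<close>, the functional that separates them has the form
  $(t, t') \mapsto \langle t, v'\rangle + \langle t', v''\rangle$ and vanishes on the subspace \<open>S\<close>. By hypothesis it
  vanishes at $(x, x')$ as well, so it does not separate.
\<close>
lemma closed_subspace_mem_of_annihilator:
  fixes S :: "('a::real_normed_vector \<times> 'a dual) set" and x :: 'a and x' :: "'a dual"
  assumes S: "subspace S" "closed S"
    and ann: "\<And>(u'' :: 'a bidual) u'. (\<And>a a'. (a, a') \<in> S \<Longrightarrow> blinfun_apply u' a = blinfun_apply u'' a') \<Longrightarrow>
      blinfun_apply u' x = blinfun_apply u'' x'"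
  shows "(x, x') \<in> S"
proof (rule ccontr)
  assume "(x, x') \<notin> S"
  moreover have "open (- S)" using S(2) by (rule open_Compl)
  ultimately obtain \<epsilon> where \<epsilon>: "0 < \<epsilon>" "ball (x, x') \<epsilon> \<subseteq> - S"
    unfolding open_contains_ball by blast
  let ?C = "(\<lambda>s. s - (x, x')) ` S"
  have C: "convex ?C" "?C \<noteq> {}"
    using S(1) subspace_0[OF S(1)] by (auto intro: convex_translation_subtract subspace_imp_convex)
  have far: "\<epsilon> \<le> 1 * norm c" if c: "c \<in> ?C" for c
  proof -
    obtain s where s: "s \<in> S" "c = s - (x, x')" using c by blast
    then have "s \<notin> ball (x, x') \<epsilon>" using \<epsilon>(2) by blast
    then show ?thesis by (simp add: s(2) dist_norm norm_minus_commute not_less)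
  qed
  obtain \<phi> where \<phi>: "linear \<phi>" "\<And>y. \<phi> y \<le> 1 * norm y" "\<And>c. c \<in> ?C \<Longrightarrow> \<epsilon> \<le> \<phi> c"
    using separate_from_sublinear_ball[OF sublinear_norm[of 1] C far] by auto
  interpret \<phi>: linear \<phi> by (rule \<phi>(1))
  have lin: "linear (\<lambda>t. \<phi> (t, 0))" "linear (\<lambda>t'. \<phi> (0, t'))"
    by (rule linear_compose[OF linearI \<phi>(1), unfolded comp_def]; simp)+
  have le': "\<phi> (t, 0) \<le> 1 * norm t" and le'': "\<phi> (0, t') \<le> 1 * norm t'" for t t'
    using \<phi>(2)[of "(t, 0)"] \<phi>(2)[of "(0, t')"] by simp_all
  obtain v' :: "'a dual" where v': "\<And>t. blinfun_apply v' t = \<phi> (t, 0)"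
    using blinfun_of_dominated_linear[OF lin(1) le' zero_le_one] by blast
  obtain v'' :: "'a bidual" where v'': "\<And>t. blinfun_apply v'' t = \<phi> (0, t)"
    using blinfun_of_dominated_linear[OF lin(2) le'' zero_le_one] by blast
  have split: "\<phi> (t, t') = blinfun_apply v' t + blinfun_apply v'' t'" for t t'
    by (simp add: v' v'' \<phi>.add[symmetric])
  have ge: "\<epsilon> + \<phi> (x, x') \<le> \<phi> s" if "s \<in> S" for s
    using \<phi>(3)[of "s - (x, x')"] that by (simp add: \<phi>.diff)
  have zero: "\<phi> s = 0" if "s \<in> S" for s
  proof (rule eq_zero_of_multiples_bounded_below)
    show "\<epsilon> + \<phi> (x, x') \<le> t * \<phi> s" for t
      using ge[OF subspace_scale[OF S(1) that]] by (simp add: \<phi>.scale)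
  qed
  have "blinfun_apply v' a = blinfun_apply (- v'') a'" if "(a, a') \<in> S" for a a'
    using zero[OF that] split[of a a'] by (simp add: blinfun.minus_left eq_neg_iff_add_eq_0)
  then have "blinfun_apply v' x = blinfun_apply (- v'') x'" by (rule ann)
  then have "\<phi> (x, x') = 0" by (simp add: split blinfun.minus_left)
  then show False using ge[OF subspace_0[OF S(1)]] \<epsilon>(1) by (simp add: \<phi>.zero)
qed

lemma eventually_in_net:
  assumes dir: "directed_set I le"
  shows "\<forall>\<^sub>F i in net_filter I le. i \<in> I"
proof -
  obtain i where "i \<in> I" using dir unfolding directed_set_def by blast
  then show ?thesis unfolding eventually_net_filter[OF dir] by blast
qed

lemma net_filter_neq_bot:
  assumes dir: "directed_set I le"
  shows "net_filter I le \<noteq> bot"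
proof
  assume "net_filter I le = bot"
  then have "eventually (\<lambda>_. False) (net_filter I le)" by simp
  then obtain i where "i \<in> I" "\<not> le i i" unfolding eventually_net_filter[OF dir] by blast
  then show False using dir by (simp add: directed_set_def)
qed

text \<open>
  The first factor stays bounded and the second tends to 0 in norm. The base point \<open>y''\<close> is the weak*
  limit when type (NI) is derived, and \<open>canon x\<close> when type (FP) is.
\<close>
lemma bounded_net_conv_pairing_tendsto_zero:
  assumes "bounded_net_conv G I le a a' x'' x'"
  shows "((\<lambda>i. blinfun_apply (canon (a i) - y'') (a' i - x')) \<longlongrightarrow> 0) (net_filter I le)"
proof -
  have dir: "directed_set I le" and bd: "bounded ((\<lambda>i. (a i, a' i)) ` I)"
    and lim: "(a' \<longlongrightarrow> x') (net_filter I le)"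
    using assms by (auto simp: bounded_net_conv_def)
  obtain B where B: "\<And>i. i \<in> I \<Longrightarrow> norm (a i, a' i) \<le> B" using bd by (auto simp: bounded_iff)
  have "norm (blinfun_apply (canon (a i) - y'') (a' i - x')) \<le> (B + norm y'') * norm (a' i - x')"
    if "i \<in> I" for i
  proof -
    have "norm (canon (a i) - y'') \<le> norm (canon (a i)) + norm y''" by (rule norm_triangle_ineq4)
    also have "norm (canon (a i)) \<le> norm (a i)"
    proof (rule norm_blinfun_bound)
      show "norm (blinfun_apply (canon (a i)) y) \<le> norm (a i) * norm y" for y
        using norm_blinfun[of y "a i"] by (simp add: mult.commute)
    qed simp
    also have "\<dots> \<le> B" using norm_fst_le[of "a i" "a' i"] B[OF that] by linarith
    finally have "norm (canon (a i) - y'') * norm (a' i - x') \<le> (B + norm y'') * norm (a' i - x')"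
      by (intro mult_right_mono) auto
    then show ?thesis using norm_blinfun[of "canon (a i) - y''" "a' i - x'"] by linarith
  qed
  then have le: "\<forall>\<^sub>F i in net_filter I le.
      norm (blinfun_apply (canon (a i) - y'') (a' i - x')) \<le> (B + norm y'') * norm (a' i - x')"
    using eventually_in_net[OF dir] by (rule eventually_mono[rotated])
  have "((\<lambda>i. (B + norm y'') * norm (a' i - x')) \<longlongrightarrow> (B + norm y'') * norm (x' - x')) (net_filter I le)"
    by (intro tendsto_intros lim)
  then have "((\<lambda>i. (B + norm y'') * norm (a' i - x')) \<longlongrightarrow> 0) (net_filter I le)" by simp
  then show ?thesis by (rule Lim_null_comparison[OF le])
qed

lemma type_D_imp_type_NI:
  fixes A :: "'a::real_normed_vector \<Rightarrow> 'a dual set"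
  assumes D: "type_D A"
  shows "type_NI A"
  unfolding type_NI_def
proof (intro allI, rule ccontr)
  fix x'' :: "'a bidual" and x' :: "'a dual"
  let ?h = "\<lambda>(a, a'). blinfun_apply x' a + blinfun_apply x'' a' - blinfun_apply a' a"
  let ?g = "\<lambda>(a, a'). blinfun_apply (canon a - x'') (a' - x')"
  assume "\<not> ereal (blinfun_apply x'' x') \<le> (SUP (a, a') \<in> gra A.
      ereal (blinfun_apply x' a + blinfun_apply x'' a' - blinfun_apply a' a))"
  then have "(SUP s \<in> gra A. ereal (?h s)) < ereal (blinfun_apply x'' x')"
    by (simp add: case_prod_beta not_le)
  then obtain r where r: "(SUP s \<in> gra A. ereal (?h s)) < ereal r" "r < blinfun_apply x'' x'"
    using ereal_dense2[of _ "ereal (blinfun_apply x'' x')"] by (force simp only: less_ereal.simps(1))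
  \<comment> \<open>If (NI) fails, the pairing in (D) is bounded below by a positive number.\<close>
  have gap: "blinfun_apply x'' x' - r \<le> ?g s" if "s \<in> gra A" for s
  proof -
    have "ereal (?h s) \<le> ereal r" using SUP_upper[OF that, of "\<lambda>s. ereal (?h s)"] r(1)
      by (meson less_imp_le order_trans)
    then show ?thesis
      by (simp add: case_prod_beta blinfun.diff_left blinfun.diff_right)
  qed
  have "0 \<le> (INF (a, a') \<in> gra A. ereal (blinfun_apply (canon a - x'') (a' - x')))"
    using gap r(2) by (intro INF_greatest) fastforce
  then obtain I le a a' where conv: "bounded_net_conv (gra A) (I :: ('a bidual \<times> 'a dual) set set) le a a' x'' x'"
    using D unfolding type_D_def by blast
  then have dir: "directed_set I le" and inA: "\<And>i. i \<in> I \<Longrightarrow> (a i, a' i) \<in> gra A"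
    by (auto simp: bounded_net_conv_def)
  have "blinfun_apply x'' x' - r \<le> 0"
  proof (rule tendsto_lowerbound[OF bounded_net_conv_pairing_tendsto_zero[OF conv]])
    show "\<forall>\<^sub>F i in net_filter I le. blinfun_apply x'' x' - r \<le> blinfun_apply (canon (a i) - x'') (a' i - x')"
      using eventually_in_net[OF dir] by (rule eventually_mono) (use gap inA in fastforce)
    show "net_filter I le \<noteq> bot" by (rule net_filter_neq_bot[OF dir])
  qed
  then show False using r(2) by simp
qed

section \<open>The four properties compared\<close>

lemma mem_adjoint_rel:
  "x' \<in> adjoint_rel A x'' \<longleftrightarrow> (\<forall>a a'. (a, a') \<in> gra A \<longrightarrow> blinfun_apply x' a = blinfun_apply x'' a')"
  unfolding adjoint_rel_def by auto

lemma monotone_bidual_adjoint_iff: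
  "monotone_bidual (adjoint_rel A) \<longleftrightarrow> (\<forall>x''. \<forall>x'\<in>adjoint_rel A x''. 0 \<le> blinfun_apply x'' x')"
    (is "?L \<longleftrightarrow> ?R")
proof
  assume ?L
  moreover have "(0, 0) \<in> gra (adjoint_rel A)" by (simp add: gra_def mem_adjoint_rel)
  ultimately show ?R unfolding monotone_bidual_def by (force simp: gra_def)
next
  assume R: ?R
  have "x' - y' \<in> adjoint_rel A (x'' - y'')" if "x' \<in> adjoint_rel A x''" "y' \<in> adjoint_rel A y''"
    for x' x'' y' y''
    using that by (simp add: mem_adjoint_rel blinfun.diff_left)
  then show ?L using R unfolding monotone_bidual_def by (auto simp: gra_def)
qed

lemma monotone_opD:
  assumes "monotone_op A" "(a, a') \<in> gra A" "(b, b') \<in> gra A"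
  shows "0 \<le> blinfun_apply (a' - b') (a - b)"
proof -
  have "\<forall>p\<in>gra A. \<forall>q\<in>gra A. 0 \<le> blinfun_apply (snd p - snd q) (fst p - fst q)"
    using assms(1) by (simp add: monotone_wrt_def case_prod_beta)
  from this[rule_format, OF assms(2,3)] show ?thesis by simp
qed

lemma linear_relation_zero: "linear_relation A \<Longrightarrow> (0, 0) \<in> gra A"
  using subspace_0[of "gra A"] by (simp add: linear_relation_def zero_prod_def)

lemma monotone_op_nonneg:
  assumes "linear_relation A" "monotone_op A" "(a, a') \<in> gra A"
  shows "0 \<le> blinfun_apply a' a"
proof -
  from monotone_opD[OF assms(2,3) linear_relation_zero[OF assms(1)]] show ?thesis by simp
qed

text \<open>
  At \<open>(- x'', x')\<close> with \<open>x'\<close> in the adjoint at \<open>x''\<close>, the two linear terms of (NI) cancel and the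
  supremum is that of the nonpositive function $-q$.
\<close>
lemma type_NI_imp_adjoint_monotone:
  fixes A :: "'a::real_normed_vector \<Rightarrow> 'a dual set"
  assumes lin: "linear_relation A" and mono: "monotone_op A" and NI: "type_NI A"
  shows "monotone_bidual (adjoint_rel A)"
  unfolding monotone_bidual_adjoint_iff
proof (intro allI ballI)
  fix x'' x' assume x: "x' \<in> adjoint_rel A x''"
  have "ereal (blinfun_apply (- x'') x') \<le> (SUP (a, a') \<in> gra A.
      ereal (blinfun_apply x' a + blinfun_apply (- x'') a' - blinfun_apply a' a))"
    using NI unfolding type_NI_def by blast
  also have "\<dots> \<le> ereal 0"
  proof (rule SUP_least, clarify)
    fix a a' assume "(a, a') \<in> gra A"
    then show "ereal (blinfun_apply x' a + blinfun_apply (- x'') a' - blinfun_apply a' a) \<le> ereal 0"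
      using x monotone_op_nonneg[OF lin mono] by (simp add: mem_adjoint_rel blinfun.minus_left)
  qed
  finally show "0 \<le> blinfun_apply x'' x'" by (simp add: blinfun.minus_left)
qed

text \<open>
  Suppose $\langle x', x''\rangle = -\delta < 0$. For $(a, a')$ in the graph of $A$,
  $\langle a + x'', a' - x'\rangle = q(a, a') + \delta$, so $(-x'', x')$ is monotonically related to the graph with room
  to spare. Choose $x \in X$ with $\langle x, x'\rangle = \delta = \langle x', -x''\rangle$. On a neighbourhood of the segment from 0
  to $x'$ of radius $\rho$, the elements $x$ and $-x''$ differ by at most $\rho (\|x\| + \|x''\|)$, and so $(x, x')$ is
  monotonically related to the graph over this neighbourhood. By (FP) it would lie in the graph, and then
  $\langle x, x'\rangle = \langle x', x''\rangle$, that is $\delta = -\delta$.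
\<close>
lemma type_FP_imp_adjoint_monotone:
  fixes A :: "'a::real_normed_vector \<Rightarrow> 'a dual set"
  assumes lin: "linear_relation A" and mono: "monotone_op A" and FP: "type_FP A"
  shows "monotone_bidual (adjoint_rel A)"
  unfolding monotone_bidual_adjoint_iff
proof (intro allI ballI, rule ccontr)
  fix x'' x' assume adj: "x' \<in> adjoint_rel A x''" and neg: "\<not> 0 \<le> blinfun_apply x'' x'"
  define \<delta> where "\<delta> = - blinfun_apply x'' x'"
  have \<delta>: "0 < \<delta>" using neg by (simp add: \<delta>_def)
  have "x' \<noteq> 0" using \<delta> by (auto simp: \<delta>_def)
  then obtain y where y: "blinfun_apply x' y \<noteq> 0"
    using blinfun_eqI[of x' 0] by auto
  define x where "x = (\<delta> / blinfun_apply x' y) *\<^sub>R y"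
  have x: "blinfun_apply x' x = \<delta>" using y by (simp add: x_def blinfun.scaleR_right)
  define \<rho> where "\<rho> = \<delta> / (norm x'' + norm x + 1)"
  have \<rho>: "0 < \<rho>" using \<delta> by (auto simp: \<rho>_def intro!: divide_pos_pos add_nonneg_pos)
  have \<rho>_le: "\<rho> * (norm x'' + norm x) \<le> \<delta>"
  proof -
    have "\<rho> * (norm x'' + norm x + 1) = \<delta>"
      using add_nonneg_pos[of "norm x'' + norm x" 1] by (simp add: \<rho>_def)
    then show ?thesis using \<rho> by (simp add: distrib_left)
  qed
  let ?V = "\<Union>v\<in>closed_segment 0 x'. \<Union>b\<in>ball 0 \<rho>. {v + b}"
  have V: "open ?V" "convex ?V" by (auto intro!: open_sums convex_sums)
  have V_mem: "v \<in> ?V" if "v \<in> closed_segment 0 x'" for v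
    by (rule UN_I[OF that], rule UN_I[of 0]) (use \<rho> in simp_all)
  have "0 \<in> ran A" using linear_relation_zero[OF lin] by (auto simp: gra_def ran_def)
  then have "?V \<inter> ran A \<noteq> {}" using V_mem[OF ends_in_segment(1)] by blast
  then have max: "maximally_monotone_wrt UNIV ?V A"
    using FP V unfolding type_FP_def by blast
  have rel: "0 \<le> blinfun_apply (x' - a') (x - a)" if a: "(a, a') \<in> gra A" "a' \<in> ?V" for a a'
  proof -
    obtain t b where t: "a' = t *\<^sub>R x' + b" "norm b < \<rho>"
      using a(2) by (auto simp: closed_segment_def)
    have xa: "blinfun_apply x' a = blinfun_apply x'' a'" using adj a(1) by (simp add: mem_adjoint_rel)
    have "blinfun_apply x'' b \<le> norm x'' * \<rho>"
      using norm_blinfun[of x'' b] mult_left_mono[of "norm b" \<rho> "norm x''"] t(2) by simp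
    moreover have "blinfun_apply b x \<le> \<rho> * norm x"
      using norm_blinfun[of b x] mult_right_mono[of "norm b" \<rho> "norm x"] t(2) by simp
    moreover have "blinfun_apply x'' a' + blinfun_apply a' x = blinfun_apply x'' b + blinfun_apply b x"
      by (simp add: t x \<delta>_def[symmetric] blinfun.add_left blinfun.add_right blinfun.scaleR_left
          blinfun.scaleR_right) (simp add: \<delta>_def)
    ultimately have "blinfun_apply x'' a' + blinfun_apply a' x \<le> \<delta>"
      using \<rho>_le by (simp add: algebra_simps)
    then show ?thesis
      using monotone_op_nonneg[OF lin mono a(1)] xa x by (simp add: blinfun.diff_left blinfun.diff_right)
  qed
  have "x' \<in> ?V" by (rule V_mem) simp
  moreover have "\<forall>(a, a')\<in>gra A \<inter> UNIV \<times> ?V. 0 \<le> blinfun_apply (x' - a') (x - a)"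
    using rel by blast
  ultimately have "x' \<in> A x" using max unfolding maximally_monotone_wrt_iff by blast
  then have "blinfun_apply x' x = blinfun_apply x'' x'" using adj by (simp add: mem_adjoint_rel gra_def)
  then show False using x \<delta> by (simp add: \<delta>_def)
qed

lemma adjoint_monotone_imp_annihilates:
  fixes A :: "'a::real_normed_vector \<Rightarrow> 'a dual set"
  assumes lin: "linear_relation A" and mono: "monotone_op A"
    and adj: "monotone_bidual (adjoint_rel A)"
    and rel: "\<And>a a'. (a, a') \<in> gra A \<Longrightarrow> 0 \<le> blinfun_apply (canon a - x'') (a' - x')"
    and u: "\<And>a a'. (a, a') \<in> gra A \<Longrightarrow> blinfun_apply u' a = blinfun_apply u'' a'"
  shows "blinfun_apply x'' u' = blinfun_apply u'' x'"
proof (rule monotonically_related_imp_annihilates[OF _ _ _ rel u])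
  show "subspace (gra A)" using lin by (simp add: linear_relation_def)
  show "0 \<le> blinfun_apply a' a" if "(a, a') \<in> gra A" for a a'
    using monotone_op_nonneg[OF lin mono that] .
  show "0 \<le> blinfun_apply w'' w'" if "\<And>a a'. (a, a') \<in> gra A \<Longrightarrow> blinfun_apply w' a = blinfun_apply w'' a'"
    for w'' w'
    using adj that unfolding monotone_bidual_adjoint_iff by (simp add: mem_adjoint_rel)
qed

lemma adjoint_monotone_imp_maximally_monotone:
  fixes A :: "'a::real_normed_vector \<Rightarrow> 'a dual set"
  assumes lin: "linear_relation A" and mono: "monotone_op A" and closed: "closed (gra A)"
    and adj: "monotone_bidual (adjoint_rel A)"
  shows "maximally_monotone A"
  unfolding maximally_monotone_wrt_iff
proof (intro conjI ballI impI)
  fix x x' assume *: "\<forall>(a, a')\<in>gra A \<inter> UNIV \<times> UNIV. 0 \<le> blinfun_apply (x' - a') (x - a)"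
  have rel: "0 \<le> blinfun_apply (canon a - canon x) (a' - x')" if "(a, a') \<in> gra A" for a a'
  proof -
    have "blinfun_apply (canon a - canon x) (a' - x') = blinfun_apply (x' - a') (x - a)"
      by (simp add: blinfun.diff_left blinfun.diff_right)
    then show ?thesis using * that by auto
  qed
  have "blinfun_apply u' x = blinfun_apply u'' x'"
    if "\<And>a a'. (a, a') \<in> gra A \<Longrightarrow> blinfun_apply u' a = blinfun_apply u'' a'" for u' and u'' :: "'a bidual"
    using adjoint_monotone_imp_annihilates[OF lin mono adj rel that] by simp
  then have "(x, x') \<in> gra A"
    using closed_subspace_mem_of_annihilator[OF _ closed] lin unfolding linear_relation_def by blast
  then show "x' \<in> A x" by (simp add: gra_def)
qed (rule mono)

lemma adjoint_monotone_imp_type_D: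
  fixes A :: "'a::real_normed_vector \<Rightarrow> 'a dual set"
  assumes lin: "linear_relation A" and mono: "monotone_op A"
    and adj: "monotone_bidual (adjoint_rel A)"
  shows "type_D A"
  unfolding type_D_def
proof (intro allI impI)
  fix x'' x'
  assume inf: "0 \<le> (INF (a, a') \<in> gra A. ereal (blinfun_apply (canon a - x'') (a' - x')))"
  have rel: "0 \<le> blinfun_apply (canon a - x'') (a' - x')" if "(a, a') \<in> gra A" for a a'
  proof -
    have "0 \<le> ereal (blinfun_apply (canon a - x'') (a' - x'))"
      using order_trans[OF inf INF_lower[OF that]] by simp
    then show ?thesis by simp
  qed
  have "\<exists>(I :: ('a dual set \<times> nat) set) le a a'. bounded_net_conv (gra A) I le a a' x'' x'"
    using lin adjoint_monotone_imp_annihilates[OF lin mono adj rel]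
    unfolding linear_relation_def by (intro bounded_net_of_annihilator) auto
  then show "\<exists>(I :: ('a bidual \<times> 'a dual) set set) le a a'. bounded_net_conv (gra A) I le a a' x'' x'"
    using bounded_net_conv_any_index by blast
qed

text \<open>
  Monotonicity is convexity of the shifted pairing along the segment: the defect is
  $\alpha \beta \langle a - b, a' - b'\rangle$.
\<close>
lemma convex_combination_pairing_le:
  fixes a b :: "'a::real_normed_vector" and a' b' :: "'a dual"
  assumes "0 \<le> blinfun_apply (a' - b') (a - b)" and ab: "0 \<le> \<alpha>" "0 \<le> \<beta>" "\<alpha> + \<beta> = 1"
  shows "blinfun_apply (\<alpha> *\<^sub>R a' + \<beta> *\<^sub>R b' - x') (\<alpha> *\<^sub>R a + \<beta> *\<^sub>R b - x)
    \<le> \<alpha> * blinfun_apply (a' - x') (a - x) + \<beta> * blinfun_apply (b' - x') (b - x)"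
proof -
  have \<beta>: "\<beta> = 1 - \<alpha>" using ab by simp
  have "\<alpha> * blinfun_apply (a' - x') (a - x) + \<beta> * blinfun_apply (b' - x') (b - x)
      - blinfun_apply (\<alpha> *\<^sub>R a' + \<beta> *\<^sub>R b' - x') (\<alpha> *\<^sub>R a + \<beta> *\<^sub>R b - x)
      = \<alpha> * \<beta> * blinfun_apply (a' - b') (a - b)"
    unfolding \<beta>
    by (simp add: blinfun.diff_left blinfun.diff_right blinfun.add_left blinfun.add_right
        blinfun.scaleR_left blinfun.scaleR_right algebra_simps)
  moreover have "0 \<le> \<alpha> * \<beta> * blinfun_apply (a' - b') (a - b)" using assms by simp
  ultimately show ?thesis by linarith
qed

text \<open>
  The function $\langle a - x, a' - x'\rangle$ is convex on the graph and nonnegative where $a' \in V$. Its multiplier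
  for the constraint $a' \in V$ exists because \<open>V\<close> is open and meets the range: this is Slater's condition,
  which makes the set \<open>?G\<close> absorbing and the multiplier bounded.
\<close>
lemma lagrange_multiplier_open_range_constraint:
  fixes A :: "'a::real_normed_vector \<Rightarrow> 'a dual set"
  assumes lin: "linear_relation A" and mono: "monotone_op A"
    and V: "open V" "convex V" "V \<inter> ran A \<noteq> {}"
    and rel: "\<And>a a'. (a, a') \<in> gra A \<Longrightarrow> a' \<in> V \<Longrightarrow> 0 \<le> blinfun_apply (a' - x') (a - x)"
  obtains \<phi> :: "'a bidual" where
    "\<And>v a a'. v \<in> V \<Longrightarrow> (a, a') \<in> gra A \<Longrightarrow> blinfun_apply \<phi> (v - a') \<le> blinfun_apply (a' - x') (a - x)"
proof -
  have S: "subspace (gra A)" using lin by (simp add: linear_relation_def)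
  let ?f = "\<lambda>a a'. blinfun_apply (a' - x') (a - x)"
  let ?G = "{(v - a', r) | v a a' r. v \<in> V \<and> (a, a') \<in> gra A \<and> ?f a a' \<le> r}"
  obtain a0 a0' where a0: "(a0, a0') \<in> gra A" "a0' \<in> V" using V(3) by (auto simp: gra_def ran_def)
  obtain \<rho> where \<rho>: "0 < \<rho>" "ball a0' \<rho> \<subseteq> V" using V(1) a0(2) unfolding open_contains_ball by blast
  define M where "M = ?f a0 a0'"
  have M: "0 \<le> M" unfolding M_def by (rule rel[OF a0])
  have ball: "(y, M) \<in> ?G" if "norm y < \<rho>" for y
  proof -
    have "a0' + y \<in> V" using that \<rho>(2) by (auto simp: dist_norm)
    then have "\<exists>v a a' r. (y, M) = (v - a', r) \<and> v \<in> V \<and> (a, a') \<in> gra A \<and> ?f a a' \<le> r"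
      using a0 by (intro exI[of _ "a0' + y"] exI[of _ a0] exI[of _ a0'] exI[of _ M]) (simp add: M_def)
    then show ?thesis by blast
  qed
  have "convex ?G"
  proof (rule convexI)
    fix g1 g2 :: "'a dual \<times> real" and \<alpha> \<beta> :: real
    assume g: "g1 \<in> ?G" "g2 \<in> ?G" and ab: "0 \<le> \<alpha>" "0 \<le> \<beta>" "\<alpha> + \<beta> = 1"
    obtain v a a' r w b b' q where
      1: "g1 = (v - a', r)" "v \<in> V" "(a, a') \<in> gra A" "?f a a' \<le> r" and
      2: "g2 = (w - b', q)" "w \<in> V" "(b, b') \<in> gra A" "?f b b' \<le> q" using g by blast
    from convex_combination_pairing_le[OF monotone_opD[OF mono 1(3) 2(3)] ab]
    have "?f (\<alpha> *\<^sub>R a + \<beta> *\<^sub>R b) (\<alpha> *\<^sub>R a' + \<beta> *\<^sub>R b') \<le> \<alpha> * ?f a a' + \<beta> * ?f b b'" .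
    also have "\<dots> \<le> \<alpha> * r + \<beta> * q" using 1 2 ab by (intro add_mono mult_left_mono)
    finally have le: "?f (\<alpha> *\<^sub>R a + \<beta> *\<^sub>R b) (\<alpha> *\<^sub>R a' + \<beta> *\<^sub>R b') \<le> \<alpha> * r + \<beta> * q" .
    have "\<alpha> *\<^sub>R (a, a') + \<beta> *\<^sub>R (b, b') \<in> gra A"
      using 1 2 by (intro subspace_add[OF S] subspace_scale[OF S])
    then have "(\<alpha> *\<^sub>R a + \<beta> *\<^sub>R b, \<alpha> *\<^sub>R a' + \<beta> *\<^sub>R b') \<in> gra A" by simp
    moreover have "\<alpha> *\<^sub>R v + \<beta> *\<^sub>R w \<in> V" using convexD[OF V(2)] 1 2 ab by blast
    moreover have "\<alpha> *\<^sub>R g1 + \<beta> *\<^sub>R g2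
        = ((\<alpha> *\<^sub>R v + \<beta> *\<^sub>R w) - (\<alpha> *\<^sub>R a' + \<beta> *\<^sub>R b'), \<alpha> * r + \<beta> * q)"
      unfolding 1 2 by (simp add: algebra_simps)
    ultimately show "\<alpha> *\<^sub>R g1 + \<beta> *\<^sub>R g2 \<in> ?G" using le by blast
  qed
  moreover have "\<exists>t>0. \<exists>r. (t *\<^sub>R y, r) \<in> ?G" for y
  proof -
    have "0 < norm y + 1" by (simp add: add_nonneg_pos)
    then have "norm ((\<rho> / (norm y + 1)) *\<^sub>R y) < \<rho>" "0 < \<rho> / (norm y + 1)"
      using \<rho>(1) by (simp_all add: field_simps)
    then show ?thesis using ball by blast
  qed
  moreover have "0 \<le> r" if "(0, r) \<in> ?G" for r
    using that rel by fastforce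
  ultimately obtain f where f: "linear f" "\<And>y r. (y, r) \<in> ?G \<Longrightarrow> f y \<le> r"
    using linear_minorant_of_convex_set[of ?G] by blast
  have "f y \<le> 2 * M / \<rho> * norm y" for y
  proof (cases "y = 0")
    case False
    let ?t = "\<rho> / (2 * norm y)"
    have "norm (?t *\<^sub>R y) < \<rho>" using False \<rho>(1) by simp
    then have "f (?t *\<^sub>R y) \<le> M" by (intro f(2) ball)
    then show ?thesis using False \<rho>(1) by (simp add: linear_scale[OF f(1)] field_simps)
  qed (simp add: linear_0[OF f(1)])
  moreover have "0 \<le> 2 * M / \<rho>" using M \<rho>(1) by simp
  ultimately obtain \<phi> :: "'a bidual" where \<phi>: "\<And>y. blinfun_apply \<phi> y = f y"
    using blinfun_of_dominated_linear[OF f(1)] by blast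
  show thesis
  proof (rule that)
    fix v a a' assume "v \<in> V" "(a, a') \<in> gra A"
    then show "blinfun_apply \<phi> (v - a') \<le> ?f a a'" unfolding \<phi> by (intro f(2)) blast
  qed
qed

lemma blinfun_eq_zero_of_nonpos_near:
  fixes \<phi> :: "'v::real_normed_vector dual"
  assumes "open V" "x \<in> V" and le: "\<And>v. v \<in> V \<Longrightarrow> blinfun_apply \<phi> (v - x) \<le> 0"
  shows "\<phi> = 0"
proof (rule blinfun_eqI)
  obtain \<rho> where \<rho>: "0 < \<rho>" "ball x \<rho> \<subseteq> V" using assms(1,2) unfolding open_contains_ball by blast
  have nonpos: "blinfun_apply \<phi> y \<le> 0" for y
  proof -
    let ?t = "\<rho> / (norm y + 1)"
    have "0 < norm y + 1" by (simp add: add_nonneg_pos)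
    then have t: "0 < ?t" "norm (?t *\<^sub>R y) < \<rho>" using \<rho>(1) by (simp_all add: field_simps)
    then have "x + ?t *\<^sub>R y \<in> V" using \<rho>(2) by (auto simp: dist_norm)
    from le[OF this] have "?t * blinfun_apply \<phi> y \<le> 0" by (simp add: blinfun.scaleR_right)
    then show ?thesis using t(1) by (metis mult_pos_pos not_le)
  qed
  show "blinfun_apply \<phi> y = blinfun_apply 0 y" for y
    using nonpos[of y] nonpos[of "- y"] by (simp add: blinfun.minus_right)
qed

text \<open>
  For $v = x'$ the multiplier inequality says that $(x - \phi, x')$ is monotonically related to the whole graph.
  Along the net that (D) provides for this point the right-hand side of the inequality tends to 0, so
  $\langle v - x', \phi\rangle \le 0$ on the neighbourhood \<open>V\<close> of \<open>x'\<close>, and $\phi = 0$. The point $(x, x')$ is then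
  monotonically related to the whole graph, and maximality applies.
\<close>
lemma type_D_imp_type_FP:
  fixes A :: "'a::real_normed_vector \<Rightarrow> 'a dual set"
  assumes lin: "linear_relation A" and max: "maximally_monotone A" and D: "type_D A"
  shows "type_FP A"
  unfolding type_FP_def
proof (intro allI impI, elim conjE)
  fix V :: "'a dual set"
  assume V: "open V" "convex V" "V \<inter> ran A \<noteq> {}"
  have mono: "monotone_op A" using max by (simp add: maximally_monotone_wrt_def)
  show "maximally_monotone_wrt UNIV V A"
    unfolding maximally_monotone_wrt_iff
  proof (intro conjI ballI impI)
    show "monotone_wrt UNIV V A" using mono by (simp add: monotone_wrt_def case_prod_beta)
    fix x x' assume x': "x' \<in> V"
      and *: "\<forall>(a, a')\<in>gra A \<inter> UNIV \<times> V. 0 \<le> blinfun_apply (x' - a') (x - a)"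
    have sym: "blinfun_apply (a' - x') (a - x) = blinfun_apply (x' - a') (x - a)" for a a'
      by (simp add: blinfun.diff_left blinfun.diff_right)
    have rel: "0 \<le> blinfun_apply (a' - x') (a - x)" if "(a, a') \<in> gra A" "a' \<in> V" for a a'
      unfolding sym using * that by blast
    obtain \<phi> :: "'a bidual" where \<phi>: "\<And>v a a'. v \<in> V \<Longrightarrow> (a, a') \<in> gra A \<Longrightarrow>
        blinfun_apply \<phi> (v - a') \<le> blinfun_apply (a' - x') (a - x)"
      using lagrange_multiplier_open_range_constraint[OF lin mono V rel] by blast
    have "0 \<le> (INF (a, a') \<in> gra A. ereal (blinfun_apply (canon a - (canon x - \<phi>)) (a' - x')))"
    proof (rule INF_greatest, clarify)
      fix a a' assume a: "(a, a') \<in> gra A"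
      from \<phi>[OF x' a]
      show "0 \<le> ereal (blinfun_apply (canon a - (canon x - \<phi>)) (a' - x'))"
        by (simp add: blinfun.diff_left blinfun.diff_right)
    qed
    then obtain I le a a' where
      conv: "bounded_net_conv (gra A) (I :: ('a bidual \<times> 'a dual) set set) le a a' (canon x - \<phi>) x'"
      using D unfolding type_D_def by blast
    then have dir: "directed_set I le" and inA: "\<And>i. i \<in> I \<Longrightarrow> (a i, a' i) \<in> gra A"
      and lim: "(a' \<longlongrightarrow> x') (net_filter I le)" by (auto simp: bounded_net_conv_def)
    have "blinfun_apply \<phi> (v - x') \<le> 0" if v: "v \<in> V" for v
    proof (rule tendsto_le)
      show "net_filter I le \<noteq> bot" by (rule net_filter_neq_bot[OF dir])
      show "((\<lambda>i. blinfun_apply (canon (a i) - canon x) (a' i - x')) \<longlongrightarrow> 0) (net_filter I le)"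
        by (rule bounded_net_conv_pairing_tendsto_zero[OF conv])
      show "((\<lambda>i. blinfun_apply \<phi> (v - a' i)) \<longlongrightarrow> blinfun_apply \<phi> (v - x')) (net_filter I le)"
        by (intro tendsto_intros lim)
      show "\<forall>\<^sub>F i in net_filter I le.
          blinfun_apply \<phi> (v - a' i) \<le> blinfun_apply (canon (a i) - canon x) (a' i - x')"
        using eventually_in_net[OF dir]
      proof (rule eventually_mono)
        fix i assume "i \<in> I"
        from \<phi>[OF v inA[OF this]]
        show "blinfun_apply \<phi> (v - a' i) \<le> blinfun_apply (canon (a i) - canon x) (a' i - x')"
          by (simp add: blinfun.diff_left blinfun.diff_right)
      qed
    qed
    then have "\<phi> = 0" by (rule blinfun_eq_zero_of_nonpos_near[OF V(1) x'])
    then have "0 \<le> blinfun_apply (x' - b') (x - b)" if "(b, b') \<in> gra A" for b b'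
      using \<phi>[OF x' that] unfolding sym by simp
    then show "x' \<in> A x" using max unfolding maximally_monotone_wrt_iff by blast
  qed
qed

theorem theorem1p4:
  fixes A :: "'a::banach \<Rightarrow> 'a dual set"
  assumes "linear_relation A"
    and "monotone_op A"
    and "closed (gra A)"
  shows "(maximally_monotone A \<and> type_D A \<longleftrightarrow> maximally_monotone A \<and> type_NI A) \<and>
         (maximally_monotone A \<and> type_NI A \<longleftrightarrow> maximally_monotone A \<and> type_FP A) \<and>
         (maximally_monotone A \<and> type_FP A \<longleftrightarrow> monotone_bidual (adjoint_rel A))"
  using assms type_D_imp_type_NI type_D_imp_type_FP type_NI_imp_adjoint_monotone
    type_FP_imp_adjoint_monotone adjoint_monotone_imp_maximally_monotone adjoint_monotone_imp_type_D
  by blast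

end
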